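(* (a) Every rectangle overlap graph satisfies $\chi=O_\omega((\log\log n)^{\omega-1})$. (b) Every clean rectangle overlap graph satisfies $\chi=O_\omega(\log\log n)$.
   Context: Graphs are finite and simple; $n$, $\chi$, $\omega$ denote the number of vertices, chromatic number and clique number. $O_\omega$ denotes asymptotics in $n$ with $\omega$ fixed (the constant may depend on $\omega$). Two sets overlap if they intersect and neither contains the other. A graph $G$ is a rectangle overlap graph if there is a bijection $\mu$ from $V(G)$ to a family of closed axis-parallel rectangles in $\mathbb{R}^2$ such that $uv\in E(G)$ iff $\mu(u)$ and $\mu(v)$ overlap (an overlap model). An overlap model is clean if there are no three members such that two overlapping ones both contain the third; a rectangle overlap graph is clean if it has a clean overlap model by axis-parallel rectangles. *)

theory Defs
  imports
    Complex_Main
    "HOL-Library.Landau_Symbols"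
    "Graph_Theory.Pair_Digraph"
begin

text \<open>
  A finite simple graph is a \<open>pair_graph\<close>: a finite vertex set \<open>pverts G\<close> with a symmetric,
  loopless arc relation \<open>parcs G\<close> on it, so that \<open>uv\<close> is an edge iff \<open>(u, v) \<in> parcs G\<close>.
\<close>

definition proper_coloring :: "'a pair_pre_digraph \<Rightarrow> nat \<Rightarrow> ('a \<Rightarrow> nat) \<Rightarrow> bool" where
  "proper_coloring G k c \<longleftrightarrow>
     c ` pverts G \<subseteq> {..<k} \<and> (\<forall>(u, v) \<in> parcs G. c u \<noteq> c v)"

definition chromatic_number :: "'a pair_pre_digraph \<Rightarrow> nat" where
  "chromatic_number G = (LEAST k. \<exists>c. proper_coloring G k c)"

definition clique_in :: "'a pair_pre_digraph \<Rightarrow> 'a set \<Rightarrow> bool" where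
  "clique_in G K \<longleftrightarrow>
     K \<subseteq> pverts G \<and> (\<forall>u \<in> K. \<forall>v \<in> K. u \<noteq> v \<longrightarrow> (u, v) \<in> parcs G)"

definition clique_number :: "'a pair_pre_digraph \<Rightarrow> nat" where
  "clique_number G = Max (card ` {K. clique_in G K})"

definition overlap :: "'a set \<Rightarrow> 'a set \<Rightarrow> bool" where
  "overlap A B \<longleftrightarrow> A \<inter> B \<noteq> {} \<and> \<not> A \<subseteq> B \<and> \<not> B \<subseteq> A"

text \<open>Rectangles are non-degenerate: both sides have positive length.\<close>

definition rectangle :: "(real \<times> real) set \<Rightarrow> bool" where
  "rectangle R \<longleftrightarrow> (\<exists>a b c d. a < b \<and> c < d \<and> R = {a..b} \<times> {c..d})"

definition rectangle_overlap_model ::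
    "'a pair_pre_digraph \<Rightarrow> ('a \<Rightarrow> (real \<times> real) set) \<Rightarrow> (real \<times> real) set set \<Rightarrow> bool" where
  "rectangle_overlap_model G \<mu> \<F> \<longleftrightarrow>
     (\<forall>R \<in> \<F>. rectangle R) \<and>
     bij_betw \<mu> (pverts G) \<F> \<and>
     (\<forall>u \<in> pverts G. \<forall>v \<in> pverts G. (u, v) \<in> parcs G \<longleftrightarrow> overlap (\<mu> u) (\<mu> v))"

text \<open>
  The three members below are automatically distinct: overlapping sets are incomparable, so a set
  contained in both of them differs from each.
\<close>

definition clean_family :: "'a set set \<Rightarrow> bool" where
  "clean_family \<F> \<longleftrightarrow>
     \<not> (\<exists>A \<in> \<F>. \<exists>B \<in> \<F>. \<exists>C \<in> \<F>. overlap A B \<and> C \<subseteq> A \<and> C \<subseteq> B)"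

definition rectangle_overlap_graph :: "'a pair_pre_digraph \<Rightarrow> bool" where
  "rectangle_overlap_graph G \<longleftrightarrow>
     pair_graph G \<and> (\<exists>\<mu> \<F>. rectangle_overlap_model G \<mu> \<F>)"

definition clean_rectangle_overlap_graph :: "'a pair_pre_digraph \<Rightarrow> bool" where
  "clean_rectangle_overlap_graph G \<longleftrightarrow>
     pair_graph G \<and> (\<exists>\<mu> \<F>. rectangle_overlap_model G \<mu> \<F> \<and> clean_family \<F>)"

text \<open>
  \<open>chi_bigO \<G> g\<close> expresses that all graphs \<open>G\<close> in the class \<open>\<G>\<close> satisfy
  \<open>\<chi> = O\<^sub>\<omega>(g \<omega> n)\<close>, where \<open>n\<close> and \<open>\<omega>\<close> are the number of vertices and the clique number of \<open>G\<close>: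
  for each fixed \<open>\<omega>\<close>, one function of \<open>n\<close> of order \<open>O(g \<omega> n)\<close> bounds the chromatic number of every
  member of the class with clique number \<open>\<omega>\<close>.
\<close>

definition chi_bigO :: "('a pair_pre_digraph \<Rightarrow> bool) \<Rightarrow> (nat \<Rightarrow> nat \<Rightarrow> real) \<Rightarrow> bool" where
  "chi_bigO \<G> g \<longleftrightarrow>
     (\<forall>\<omega>. \<exists>f :: nat \<Rightarrow> real. f \<in> O(g \<omega>) \<and>
        (\<forall>G. \<G> G \<and> clique_number G = \<omega> \<longrightarrow>
           real (chromatic_number G) \<le> f (card (pverts G))))"

end

theory Submission
  imports Defs "HOL-Real_Asymp.Real_Asymp"
begin

text \<open>
  In a clean family the members containing a given one form a chain, so overlapping members \<open>S\<close>, \<open>Q\<close>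
  have a least common container \<open>N\<close>, and the largest containers \<open>S'\<close> of \<open>S\<close> and \<open>Q'\<close> of \<open>Q\<close> properly
  inside \<open>N\<close> (their hats) overlap. Pairs in which one rectangle crosses the other from side to side
  are ordered transitively and cost \<open>\<omega>\<close> colours; otherwise a corner of one hat lies in the other.
  Only boundedly many containers of a rectangle \<open>A\<close> are least common containers of \<open>A\<close> and a
  rectangle through a corner of \<open>A\<close>. Colouring nodes so that each differs from these containers
  leaves, up to \<open>O\<^sub>\<omega>(1)\<close> colours, only overlaps in which one hat enters the other through a side,
  and no member is the entering one both for a horizontal and for a vertical overlap. So \<open>O\<^sub>\<omega>(1)\<close>
  classes have, say, no overlap whose hats have nested horizontal projections.

  For such a class, recursive bisection by horizontal lines gives each rectangle one of \<open>O(log n)\<close>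
  levels, and rectangles through a common line need \<open>O\<^sub>\<omega>(1)\<close> colours. Colouring a rectangle by the
  first bit in which its level differs from the extreme level of a hat overlapping its own
  costs \<open>O(log log n)\<close> and leaves groups whose members all see a wall reaching beyond the group
  horizontally and vertically, hence containing a corner of a maximal member of the group; such
  groups need \<open>O\<^sub>\<omega>(1)\<close> colours.

  A general family splits into clean levels according to how deeply a member is nested in pairs of
  overlapping members; overlaps between non-consecutive levels have a smaller clique number, which
  gives the exponent \<open>\<omega> - 1\<close>.
\<close>

section \<open>Colourings\<close>

definition colb :: "'v set \<Rightarrow> ('v \<Rightarrow> 'v \<Rightarrow> bool) \<Rightarrow> nat \<Rightarrow> bool" where
  "colb D E k \<longleftrightarrow> (\<exists>f. (\<forall>x\<in>D. f x < k) \<and> (\<forall>x\<in>D. \<forall>y\<in>D. E x y \<longrightarrow> f x \<noteq> f y))"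

lemma colbI:
  assumes "\<And>x. x \<in> D \<Longrightarrow> f x < k" and "\<And>x y. x \<in> D \<Longrightarrow> y \<in> D \<Longrightarrow> E x y \<Longrightarrow> f x \<noteq> f y"
  shows "colb D E k"
  using assms unfolding colb_def by blast

lemma colbE:
  assumes "colb D E k"
  obtains f where "\<forall>x\<in>D. f x < k" and "\<forall>x\<in>D. \<forall>y\<in>D. E x y \<longrightarrow> f x \<noteq> f y"
  using assms unfolding colb_def by blast

lemma colb_mono:
  assumes "colb D E k" "D' \<subseteq> D" "k \<le> k'"
    and "\<And>x y. x \<in> D' \<Longrightarrow> y \<in> D' \<Longrightarrow> E' x y \<Longrightarrow> E x y"
  shows "colb D' E' k'"
proof -
  obtain f where "\<forall>x\<in>D. f x < k" "\<forall>x\<in>D. \<forall>y\<in>D. E x y \<longrightarrow> f x \<noteq> f y"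
    using assms(1) by (rule colbE)
  then show ?thesis
    using assms(2-4) by (intro colbI[where f=f]) (blast intro: less_le_trans, blast)
qed

lemma colb_indep:
  assumes "\<And>x y. x \<in> D \<Longrightarrow> y \<in> D \<Longrightarrow> \<not> E x y" "0 < k"
  shows "colb D E k"
  by (rule colbI[where f="\<lambda>_. 0"]) (use assms in auto)

lemma colb_split:
  assumes g: "\<And>x. x \<in> D \<Longrightarrow> g x < p" and c: "\<And>i. i < p \<Longrightarrow> colb {x\<in>D. g x = i} E q"
  shows "colb D E (p * q)"
proof -
  have "\<forall>i. \<exists>f. i < p \<longrightarrow> (\<forall>x\<in>{x\<in>D. g x = i}. f x < q) \<and>
     (\<forall>x\<in>{x\<in>D. g x = i}. \<forall>y\<in>{x\<in>D. g x = i}. E x y \<longrightarrow> f x \<noteq> f y)"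
    using c unfolding colb_def by blast
  from choice[OF this] obtain f where "\<forall>i<p. (\<forall>x\<in>{x\<in>D. g x = i}. f i x < q) \<and>
     (\<forall>x\<in>{x\<in>D. g x = i}. \<forall>y\<in>{x\<in>D. g x = i}. E x y \<longrightarrow> f i x \<noteq> f i y)" by auto
  then have f: "\<And>i x. i < p \<Longrightarrow> x \<in> D \<Longrightarrow> g x = i \<Longrightarrow> f i x < q"
     "\<And>i x y. i < p \<Longrightarrow> x \<in> D \<Longrightarrow> y \<in> D \<Longrightarrow> g x = i \<Longrightarrow> g y = i \<Longrightarrow> E x y \<Longrightarrow> f i x \<noteq> f i y"
    by auto
  show ?thesis
  \<comment> \<open>The class and the colour inside the class, written as one number with lower
    digit below \<open>q\<close>.\<close>
  proof (rule colbI[where f="\<lambda>x. g x * q + f (g x) x"])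
    fix x assume x: "x \<in> D"
    have "g x * q + f (g x) x < g x * q + q" using f(1)[OF g[OF x] x] by simp
    also have "\<dots> = Suc (g x) * q" by simp
    also have "\<dots> \<le> p * q" using g[OF x] by (intro mult_right_mono) auto
    finally show "g x * q + f (g x) x < p * q" .
  next
    fix x y assume x: "x \<in> D" and y: "y \<in> D" and e: "E x y"
    have fx: "f (g x) x < q" and fy: "f (g y) y < q" using f(1) g x y by auto
    show "g x * q + f (g x) x \<noteq> g y * q + f (g y) y"
    proof
      assume eq: "g x * q + f (g x) x = g y * q + f (g y) y"
      have "(g x * q + f (g x) x) div q = g x" "(g y * q + f (g y) y) div q = g y" using fx fy by auto
      then have "g x = g y" using eq by metis
      then show False using eq f(2)[OF g[OF x] x y refl _ e] by simp
    qed
  qed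
qed

lemma colb_split_finite:
  assumes A: "finite A" "card A \<le> p" and g: "\<And>x. x \<in> D \<Longrightarrow> g x \<in> A"
    and c: "\<And>a. a \<in> A \<Longrightarrow> colb {x\<in>D. g x = a} E q"
  shows "colb D E (p * q)"
proof -
  obtain e where e: "bij_betw e A {0..<card A}" using ex_bij_betw_finite_nat[OF A(1)] by blast
  have "colb D E (card A * q)"
  proof (rule colb_split[where g="\<lambda>x. e (g x)"])
    show "e (g x) < card A" if "x \<in> D" for x using e g[OF that] by (force simp: bij_betw_def)
    fix i assume "i < card A"
    then have "i \<in> e ` A" using e by (simp add: bij_betw_def)
    then obtain a where a: "a \<in> A" "e a = i" by blast
    have "e (g x) = i \<longleftrightarrow> g x = a" if "x \<in> D" for x
      using inj_onD[OF bij_betw_imp_inj_on[OF e], of "g x" a] a g[OF that] by auto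
    then have "{x\<in>D. e (g x) = i} = {x\<in>D. g x = a}" by blast
    then show "colb {x\<in>D. e (g x) = i} E q" using c[OF a(1)] by simp
  qed
  then show ?thesis by (rule colb_mono) (use A(2) in auto)
qed

text \<open>The tool for removing kinds of overlap one after the other: inside a class of the first
  colouring \<open>E1\<close> has disappeared, so \<open>q\<close> only pays for what is left of
  \<open>E\<close>.\<close>

lemma colb_refine:
  assumes "colb D E1 p"
    and "\<And>D'. D' \<subseteq> D \<Longrightarrow> (\<And>x y. x \<in> D' \<Longrightarrow> y \<in> D' \<Longrightarrow> \<not> E1 x y) \<Longrightarrow> colb D' E q"
  shows "colb D E (p * q)"
proof -
  obtain g where g: "\<forall>x\<in>D. g x < p" "\<forall>x\<in>D. \<forall>y\<in>D. E1 x y \<longrightarrow> g x \<noteq> g y"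
    using assms(1) by (rule colbE)
  show ?thesis
  proof (rule colb_split[where g=g])
    show "colb {x\<in>D. g x = i} E q" for i
      by (rule assms(2)) (use g in force)+
  qed (use g in auto)
qed

text \<open>No pair of \<open>E\<close> joins two blocks, so all blocks share one palette and their
  number does not enter the bound.\<close>

lemma colb_blocks:
  assumes h: "\<And>x y. x \<in> D \<Longrightarrow> y \<in> D \<Longrightarrow> E x y \<Longrightarrow> h x = h y"
    and c: "\<And>b. colb {x\<in>D. h x = b} E q"
  shows "colb D E q"
proof -
  have "\<forall>b. \<exists>f. (\<forall>x\<in>{x\<in>D. h x = b}. f x < q) \<and>
     (\<forall>x\<in>{x\<in>D. h x = b}. \<forall>y\<in>{x\<in>D. h x = b}. E x y \<longrightarrow> f x \<noteq> f y)"
    using c unfolding colb_def by blast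
  from choice[OF this] obtain f where "\<forall>b. (\<forall>x\<in>{x\<in>D. h x = b}. f b x < q) \<and>
     (\<forall>x\<in>{x\<in>D. h x = b}. \<forall>y\<in>{x\<in>D. h x = b}. E x y \<longrightarrow> f b x \<noteq> f b y)" by blast
  then have f: "\<And>x. x \<in> D \<Longrightarrow> f (h x) x < q"
     "\<And>x y. x \<in> D \<Longrightarrow> y \<in> D \<Longrightarrow> h x = h y \<Longrightarrow> E x y \<Longrightarrow> f (h x) x \<noteq> f (h y) y"
    by auto
  show ?thesis by (rule colbI[where f="\<lambda>x. f (h x) x"]) (use f h in \<open>force+\<close>)
qed

lemma colb_image:
  assumes "colb (h ` D) E k"
  shows "colb D (\<lambda>x y. E (h x) (h y)) k"
proof -
  obtain f where "\<forall>x\<in>h ` D. f x < k" "\<forall>x\<in>h ` D. \<forall>y\<in>h ` D. E x y \<longrightarrow> f x \<noteq> f y"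
    using assms by (rule colbE)
  then show ?thesis by (intro colbI[where f="\<lambda>x. f (h x)"]) auto
qed

text \<open>Degeneracy: double counting the arcs yields a vertex with at most \<open>d\<close> arcs
  in and at most \<open>d\<close> out. The rest is coloured by induction, and a colour remains free
  for this vertex.\<close>

lemma colb_outdegree:
  assumes "finite D" "\<And>x. x \<in> D \<Longrightarrow> card (out x \<inter> D) \<le> d"
    and "\<And>x y. x \<in> D \<Longrightarrow> y \<in> D \<Longrightarrow> E x y \<Longrightarrow> x \<noteq> y \<and> (y \<in> out x \<or> x \<in> out y)"
  shows "colb D E (2 * d + 1)"
  using assms
proof (induction "card D" arbitrary: D)
  case 0
  then show ?case by (auto intro: colbI)
next
  case (Suc n)
  have fin: "finite D" by fact
  have ne: "D \<noteq> {}" using Suc.hyps(2) by auto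
  have "\<exists>y\<in>D. card {x\<in>D. y \<in> out x} \<le> d"
  proof (rule ccontr)
    assume "\<not> ?thesis"
    then have "\<And>y. y \<in> D \<Longrightarrow> Suc d \<le> card {x\<in>D. y \<in> out x}" by (simp add: not_le Suc_le_eq)
    then have "(\<Sum>y\<in>D. Suc d) \<le> (\<Sum>y\<in>D. card {x\<in>D. y \<in> out x})" by (rule sum_mono)
    also have "\<dots> = (\<Sum>y\<in>D. \<Sum>x\<in>D. if y \<in> out x then 1 else 0)"
      using fin by (intro sum.cong refl) (simp add: sum.If_cases Int_def)
    also have "\<dots> = (\<Sum>x\<in>D. \<Sum>y\<in>D. if y \<in> out x then 1 else 0)" by (rule sum.swap)
    also have "\<dots> = (\<Sum>x\<in>D. card (out x \<inter> D))"
      using fin by (intro sum.cong refl) (simp add: sum.If_cases Int_commute flip: Collect_mem_eq)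
    also have "\<dots> \<le> (\<Sum>x\<in>D. d)" by (rule sum_mono) (use Suc.prems(2) in auto)
    finally show False using ne fin by (simp add: card_gt_0_iff)
  qed
  then obtain y where y: "y \<in> D" and iny: "card {x\<in>D. y \<in> out x} \<le> d" by blast
  have "colb (D - {y}) E (2 * d + 1)"
  proof (rule Suc.hyps(1))
    show "n = card (D - {y})" using Suc.hyps(2) y fin by simp
    show "finite (D - {y})" using fin by simp
    fix x assume "x \<in> D - {y}"
    then show "card (out x \<inter> (D - {y})) \<le> d"
      using Suc.prems(2)[of x] fin by (meson DiffD1 card_mono Int_mono Diff_subset finite_Int le_trans order_refl)
  qed (use Suc.prems(3) in auto)
  then obtain f where f: "\<forall>x\<in>D - {y}. f x < 2 * d + 1"
    "\<forall>x\<in>D - {y}. \<forall>z\<in>D - {y}. E x z \<longrightarrow> f x \<noteq> f z" by (rule colbE)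
  define N where "N = {x\<in>D. y \<in> out x} \<union> (out y \<inter> D)"
  have "card (f ` N) \<le> card N" by (rule card_image_le) (use fin in \<open>simp add: N_def\<close>)
  also have "\<dots> \<le> d + d" unfolding N_def
    by (rule order_trans[OF card_Un_le]) (use iny Suc.prems(2)[OF y] in linarith)
  finally have "card (f ` N) < card {..<2 * d + 1}" by simp
  then obtain c where c: "c < 2 * d + 1" "c \<notin> f ` N"
    using card_mono[of "f ` N" "{..<2 * d + 1}"] fin by (force simp: N_def)
  show ?case
  proof (rule colbI[where f="f(y := c)"])
    fix x z assume xz: "x \<in> D" "z \<in> D" "E x z"
    then have "x \<noteq> z" "z \<in> out x \<or> x \<in> out z" using Suc.prems(3) by auto
    then show "(f(y := c)) x \<noteq> (f(y := c)) z" using xz c f(2) by (auto simp: N_def)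
  qed (use f c in auto)
qed

text \<open>Mirsky's theorem: the colour of \<open>x\<close> is the largest size of a chain strictly below \<open>x\<close>.\<close>

lemma colb_mirsky:
  assumes fin: "finite D"
    and trans: "\<And>x y z. x \<in> D \<Longrightarrow> y \<in> D \<Longrightarrow> z \<in> D \<Longrightarrow> R x y \<Longrightarrow> R y z \<Longrightarrow> R x z"
    and irrefl: "\<And>x. x \<in> D \<Longrightarrow> \<not> R x x"
    and chain: "\<And>K. K \<subseteq> D \<Longrightarrow> (\<And>x y. x \<in> K \<Longrightarrow> y \<in> K \<Longrightarrow> x \<noteq> y \<Longrightarrow> R x y \<or> R y x) \<Longrightarrow> card K \<le> w"
    and E: "\<And>x y. x \<in> D \<Longrightarrow> y \<in> D \<Longrightarrow> E x y \<Longrightarrow> R x y \<or> R y x"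
  shows "colb D E w"
proof -
  define ch where "ch x = {K. K \<subseteq> D \<and> (\<forall>a\<in>K. R a x) \<and> (\<forall>a\<in>K. \<forall>b\<in>K. a \<noteq> b \<longrightarrow> R a b \<or> R b a)}" for x
  define f where "f x = Max (card ` ch x)" for x
  have finch: "finite (ch x)" for x
    by (rule finite_subset[of _ "Pow D"]) (use fin in \<open>auto simp: ch_def\<close>)
  have nech: "{} \<in> ch x" for x by (simp add: ch_def)
  have att: "\<exists>K\<in>ch x. card K = f x" for x
    using Max_in[of "card ` ch x"] finch nech unfolding f_def by fastforce
  have ins: "insert x K \<in> ch y" if "K \<in> ch x" "x \<in> D" "y \<in> D" "R x y" for x y K
    using that trans unfolding ch_def by blast
  have card_ins: "card (insert x K) = Suc (card K)" if "K \<in> ch x" "x \<in> D" for x K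
  proof -
    have "x \<notin> K" using that irrefl by (auto simp: ch_def)
    moreover have "finite K" using that fin by (auto simp: ch_def intro: finite_subset)
    ultimately show ?thesis by simp
  qed
  have less: "f x < f y" if "x \<in> D" "y \<in> D" "R x y" for x y
  proof -
    obtain K where K: "K \<in> ch x" "card K = f x" using att by blast
    have "card (insert x K) \<le> f y"
      unfolding f_def by (rule Max_ge) (use finch ins[OF K(1)] that in auto)
    then show ?thesis using card_ins[OF K(1) that(1)] K(2) by simp
  qed
  show ?thesis
  proof (rule colbI[where f=f])
    fix x assume x: "x \<in> D"
    obtain K where K: "K \<in> ch x" "card K = f x" using att by blast
    have "card (insert x K) \<le> w"
      by (rule chain) (use K x in \<open>auto simp: ch_def\<close>)
    then show "f x < w" using card_ins[OF K(1) x] K(2) by simp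
  next
    fix x y assume "x \<in> D" "y \<in> D" "E x y"
    then show "f x \<noteq> f y" using E[of x y] less[of x y] less[of y x] by auto
  qed
qed

section \<open>Clean families with corners\<close>

lemma overlap_sym: "overlap A B \<Longrightarrow> overlap B A"
  by (auto simp: overlap_def)

lemma overlap_irrefl: "\<not> overlap A A"
  by (auto simp: overlap_def)

lemma overlap_commute: "overlap A B \<longleftrightarrow> overlap B A"
  using overlap_sym by blast

definition cliques_le :: "'a set set \<Rightarrow> nat \<Rightarrow> bool" where
  "cliques_le F w \<longleftrightarrow>
     (\<forall>K \<subseteq> F. (\<forall>A\<in>K. \<forall>B\<in>K. A \<noteq> B \<longrightarrow> overlap A B) \<longrightarrow> card K \<le> w)"

lemma cliques_leD:
  assumes "cliques_le F w" "K \<subseteq> F" "\<And>A B. A \<in> K \<Longrightarrow> B \<in> K \<Longrightarrow> A \<noteq> B \<Longrightarrow> overlap A B"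
  shows "card K \<le> w"
proof -
  have "\<forall>A\<in>K. \<forall>B\<in>K. A \<noteq> B \<longrightarrow> overlap A B" by (intro ballI impI assms(3))
  from mp[OF mp[OF spec[OF assms(1)[unfolded cliques_le_def], of K] assms(2)] this] show ?thesis .
qed

lemma cliques_le_subset:
  assumes "cliques_le F w" "F' \<subseteq> F"
  shows "cliques_le F' w"
  unfolding cliques_le_def
proof (intro allI impI)
  fix K assume "K \<subseteq> F'" "\<forall>A\<in>K. \<forall>B\<in>K. A \<noteq> B \<longrightarrow> overlap A B"
  then show "card K \<le> w" using cliques_leD[OF assms(1) subset_trans[OF _ assms(2)]] by simp
qed

lemma clean_familyD:
  "clean_family F \<Longrightarrow> A \<in> F \<Longrightarrow> B \<in> F \<Longrightarrow> S \<in> F \<Longrightarrow> overlap A B \<Longrightarrow> S \<subseteq> A \<Longrightarrow> S \<subseteq> B \<Longrightarrow> False"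
  unfolding clean_family_def by blast

lemma clean_family_subset: "clean_family F \<Longrightarrow> F' \<subseteq> F \<Longrightarrow> clean_family F'"
  unfolding clean_family_def by blast

lemma chain_least:
  assumes "finite X" "X \<noteq> {}" "\<And>A B. A \<in> X \<Longrightarrow> B \<in> X \<Longrightarrow> A \<subseteq> B \<or> B \<subseteq> A"
  shows "\<Inter>X \<in> X"
proof -
  obtain m where m: "m \<in> X" "\<And>a. a \<in> X \<Longrightarrow> a \<subseteq> m \<Longrightarrow> m = a"
    using finite_has_minimal[OF assms(1,2)] by blast
  then have "m \<subseteq> a" if "a \<in> X" for a using assms(3)[OF m(1) that] m(2)[OF that] by blast
  then have "\<Inter>X = m" using m(1) by blast
  then show ?thesis using m(1) by simp
qed

lemma chain_greatest:
  assumes "finite X" "X \<noteq> {}" "\<And>A B. A \<in> X \<Longrightarrow> B \<in> X \<Longrightarrow> A \<subseteq> B \<or> B \<subseteq> A"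
  shows "\<Union>X \<in> X"
proof -
  obtain m where m: "m \<in> X" "\<And>a. a \<in> X \<Longrightarrow> m \<subseteq> a \<Longrightarrow> m = a"
    using finite_has_maximal[OF assms(1,2)] by blast
  then have "a \<subseteq> m" if "a \<in> X" for a using assms(3)[OF m(1) that] m(2)[OF that] by blast
  then have "\<Union>X = m" using m(1) by blast
  then show ?thesis using m(1) by simp
qed

text \<open>Common ground of intervals with their two end points and of non-crossing rectangles with
  their four corners. \<open>heredity\<close> holds there because a box \<open>V\<close> that
  reaches from a corner of \<open>Z\<close> to \<open>S\<close> covers the same corner of
  \<open>S\<close>. \<open>Om\<close> ensures that least common containers exist.\<close>

locale corner_family =
  fixes F :: "'a set set" and w :: nat and C :: "'c set" and cor :: "'c \<Rightarrow> 'a set \<Rightarrow> 'a"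
    and Om :: "'a set"
  assumes fin: "finite F" and ne: "A \<in> F \<Longrightarrow> A \<noteq> {}" and clean: "clean_family F"
    and root: "Om \<in> F" and below_root: "A \<in> F \<Longrightarrow> A \<subseteq> Om"
    and cliq: "cliques_le F w" and finC: "finite C"
    and heredity: "Z \<in> F \<Longrightarrow> S \<in> F \<Longrightarrow> V \<in> F \<Longrightarrow> c \<in> C \<Longrightarrow> S \<subseteq> Z \<Longrightarrow> cor c Z \<in> V \<Longrightarrow>
      V \<inter> S \<noteq> {} \<Longrightarrow> cor c S \<in> V"
    and corner: "A \<in> F \<Longrightarrow> B \<in> F \<Longrightarrow> overlap A B \<Longrightarrow> \<exists>c\<in>C. cor c A \<in> B \<or> cor c B \<in> A"
begin

lemma containers_chain:
  "S \<in> F \<Longrightarrow> X \<in> F \<Longrightarrow> Y \<in> F \<Longrightarrow> S \<subseteq> X \<Longrightarrow> S \<subseteq> Y \<Longrightarrow> X \<subseteq> Y \<or> Y \<subseteq> X"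
  using clean_familyD[OF clean, of X Y S] ne[of S] unfolding overlap_def by (metis Int_greatest subset_empty)

section \<open>Least common containers and hats\<close>

definition lca :: "'a set \<Rightarrow> 'a set \<Rightarrow> 'a set" where
  "lca S Q = \<Inter>{X\<in>F. S \<subseteq> X \<and> Q \<subseteq> X}"

text \<open>Containment makes the family a tree with root \<open>Om\<close>. For members
  \<open>S \<subset> N\<close> this union is the child of \<open>N\<close> above
  \<open>S\<close>.\<close>

definition hat :: "'a set \<Rightarrow> 'a set \<Rightarrow> 'a set" where
  "hat S N = \<Union>{X\<in>F. S \<subseteq> X \<and> X \<subset> N}"

lemma lca_in:
  assumes "S \<in> F" "Q \<in> F"
  shows "lca S Q \<in> F"
proof -
  have "lca S Q \<in> {X\<in>F. S \<subseteq> X \<and> Q \<subseteq> X}" unfolding lca_def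
  proof (rule chain_least)
    show "{X\<in>F. S \<subseteq> X \<and> Q \<subseteq> X} \<noteq> {}" using root below_root assms by blast
  qed (use fin containers_chain[OF assms(1)] in auto)
  then show ?thesis by blast
qed

lemma lca_sup: "S \<subseteq> lca S Q" "Q \<subseteq> lca S Q"
  unfolding lca_def by blast+

lemma lca_least: "X \<in> F \<Longrightarrow> S \<subseteq> X \<Longrightarrow> Q \<subseteq> X \<Longrightarrow> lca S Q \<subseteq> X"
  unfolding lca_def by blast

lemma lca_commute: "lca S Q = lca Q S"
  unfolding lca_def by (simp add: conj_commute)

lemma lca_psup: "overlap S Q \<Longrightarrow> S \<subset> lca S Q" "overlap S Q \<Longrightarrow> Q \<subset> lca S Q"
  using lca_sup(1)[of S Q] lca_sup(2)[of Q S] unfolding overlap_def by auto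

lemma hat_in:
  assumes "S \<in> F" "S \<subset> N"
  shows "hat S N \<in> {X\<in>F. S \<subseteq> X \<and> X \<subset> N}"
  unfolding hat_def
proof (rule chain_greatest)
  show "{X\<in>F. S \<subseteq> X \<and> X \<subset> N} \<noteq> {}" using assms by blast
qed (use fin containers_chain[OF assms(1)] in auto)

lemma hat_sub: "X \<in> F \<Longrightarrow> S \<subseteq> X \<Longrightarrow> X \<subset> N \<Longrightarrow> X \<subseteq> hat S N"
  unfolding hat_def by blast

text \<open>By leastness of \<open>lca S Q\<close>, a container of \<open>S\<close> strictly inside
  it cannot contain \<open>Q\<close>, and vice versa. So \<open>X\<close> and \<open>Y\<close> are
  incomparable, and they still meet.\<close>

lemma overlap_up:
  assumes SQ: "S \<in> F" "Q \<in> F" "overlap S Q" and X: "X \<in> F" "S \<subseteq> X" "X \<subset> lca S Q"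
    and Y: "Y \<in> F" "Q \<subseteq> Y" "Y \<subset> lca S Q"
  shows "overlap X Y" "lca X Y = lca S Q"
proof -
  have "\<not> Q \<subseteq> X" "\<not> S \<subseteq> Y" using lca_least[of X S Q] lca_least[of Y S Q] X Y by blast+
  then show "overlap X Y" using SQ(3) X(2) Y(2) unfolding overlap_def by blast
  show "lca X Y = lca S Q"
  proof
    show "lca X Y \<subseteq> lca S Q" using X Y lca_in[OF SQ(1,2)] by (intro lca_least) auto
    show "lca S Q \<subseteq> lca X Y"
      using lca_sup(1)[of X Y] lca_sup(2)[of Y X] X(2) Y(2) lca_in[OF X(1) Y(1)] by (intro lca_least) auto
  qed
qed

text \<open>Members \<open>V\<close> through the same corner of \<open>A\<close> with different \<open>lca A V\<close> overlap each other, so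
  \<open>solid A\<close> has bounded size.\<close>

definition solid :: "'a set \<Rightarrow> 'a set set" where
  "solid A = {lca A V | V. V \<in> F \<and> overlap A V \<and> (\<exists>c\<in>C. cor c A \<in> V)}"

text \<open>A corner of the hat is a stronger demand than a corner of \<open>S\<close>: by
  \<open>heredity\<close>, \<open>V\<close> then contains that corner of every container of
  \<open>S\<close> inside the hat.\<close>

definition genuine :: "'a set \<Rightarrow> 'a set set" where
  "genuine S = {lca S V | V. V \<in> F \<and> overlap S V \<and> (\<exists>c\<in>C. cor c (hat S (lca S V)) \<in> V)}"

definition outer :: "'a set \<Rightarrow> 'a set" where
  "outer S = \<Union>(genuine S)"

lemma solid_sub: "A \<in> F \<Longrightarrow> solid A \<subseteq> {X\<in>F. A \<subset> X}"
  unfolding solid_def using lca_in lca_psup by blast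

lemma genuine_sub: "A \<in> F \<Longrightarrow> genuine A \<subseteq> {X\<in>F. A \<subset> X}"
  unfolding genuine_def using lca_in lca_psup by blast

lemma card_solid:
  assumes A: "A \<in> F"
  shows "card (solid A) \<le> card C * w"
proof -
  define sc where "sc c = {lca A V | V. V \<in> F \<and> overlap A V \<and> cor c A \<in> V}" for c
  have "solid A = (\<Union>c\<in>C. sc c)" unfolding solid_def sc_def by blast
  moreover have "card (sc c) \<le> w" for c
  proof -
    have "\<forall>N. \<exists>V. N \<in> sc c \<longrightarrow> V \<in> F \<and> overlap A V \<and> cor c A \<in> V \<and> lca A V = N"
      unfolding sc_def by auto
    from choice[OF this] obtain v where "\<forall>N. N \<in> sc c \<longrightarrow>
      v N \<in> F \<and> overlap A (v N) \<and> cor c A \<in> v N \<and> lca A (v N) = N" by blast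
    then have v: "v N \<in> F" "overlap A (v N)" "cor c A \<in> v N" "lca A (v N) = N" if "N \<in> sc c" for N
      using that by simp_all
    have NF: "N \<in> F" "A \<subset> N" "v N \<subseteq> N" if "N \<in> sc c" for N
      using lca_in[OF A v(1)[OF that]] lca_psup(1)[OF v(2)[OF that]] lca_sup(2)[of "v N" A] v(4)[OF that]
      by simp_all
    \<comment> \<open>\<open>v M\<close> overlaps \<open>N\<close> by \<open>overlap_up\<close>, so
      it is not inside \<open>v N \<subseteq> N\<close>, and cleanness keeps \<open>v N\<close> from
      lying inside \<open>v M\<close>. Both contain the corner.\<close>
    have ov: "overlap (v N) (v M)" if NM: "N \<in> sc c" "M \<in> sc c" "N \<subset> M" for N M
    proof -
      have "A \<subseteq> N" "v M \<subset> M" using NF(2)[OF NM(1)] lca_psup(2)[OF v(2)[OF NM(2)]] v(4)[OF NM(2)] by simp_all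
      then have o: "overlap N (v M)"
        using overlap_up(1)[of A "v M" N "v M"] v[OF NM(2)] A NF[OF NM(1)] NM(3) by simp
      have "\<not> v N \<subseteq> v M"
        using clean_familyD[OF clean NF(1)[OF NM(1)] v(1)[OF NM(2)] v(1)[OF NM(1)] o] NF(3)[OF NM(1)] by blast
      moreover have "\<not> v M \<subseteq> v N" using o NF(3)[OF NM(1)] unfolding overlap_def by blast
      moreover have "v N \<inter> v M \<noteq> {}" using v(3)[OF NM(1)] v(3)[OF NM(2)] by blast
      ultimately show ?thesis unfolding overlap_def by simp
    qed
    have cmp: "N \<subset> M \<or> M \<subset> N" if "N \<in> sc c" "M \<in> sc c" "N \<noteq> M" for N M
      using containers_chain[OF A NF(1)[OF that(1)] NF(1)[OF that(2)]] NF(2)[OF that(1)] NF(2)[OF that(2)]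
        that(3) by (metis psubsetI psubset_imp_subset)
    have "inj_on v (sc c)" by (rule inj_onI) (use v(4) in metis)
    then have "card (sc c) = card (v ` sc c)" by (simp add: card_image)
    also have "\<dots> \<le> w"
    proof (rule cliques_leD[OF cliq])
      show "v ` sc c \<subseteq> F" using v(1) by blast
      fix B B' assume "B \<in> v ` sc c" "B' \<in> v ` sc c" "B \<noteq> B'"
      then obtain N M where "N \<in> sc c" "M \<in> sc c" "B = v N" "B' = v M" "N \<noteq> M" by blast
      then show "overlap B B'" using cmp ov overlap_sym by metis
    qed
    finally show ?thesis .
  qed
  ultimately show ?thesis
    using card_UN_le[OF finC, of sc] sum_bounded_above[of C "\<lambda>c. card (sc c)" w] by fastforce
qed

lemma outer_in:
  assumes "S \<in> F" "genuine S \<noteq> {}"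
  shows "outer S \<in> genuine S"
  unfolding outer_def
proof (rule chain_greatest)
  show "finite (genuine S)" using genuine_sub[OF assms(1)] fin by (auto intro: finite_subset)
  fix A B assume "A \<in> genuine S" "B \<in> genuine S"
  then have "A \<in> F" "S \<subseteq> A" "B \<in> F" "S \<subseteq> B" using genuine_sub[OF assms(1)] by blast+
  then show "A \<subseteq> B \<or> B \<subseteq> A" using containers_chain[OF assms(1)] by simp
qed fact

lemma outer_ge: "N \<in> genuine S \<Longrightarrow> N \<subseteq> outer S"
  unfolding outer_def by blast

lemma outer_F: "S \<in> F \<Longrightarrow> genuine S \<noteq> {} \<Longrightarrow> outer S \<in> F \<and> S \<subset> outer S"
  using outer_in genuine_sub by blast

lemma outer_wall:
  assumes "S \<in> F" "genuine S \<noteq> {}"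
  obtains V c where "V \<in> F" "c \<in> C" "overlap S V" "outer S = lca S V" "cor c (hat S (outer S)) \<in> V"
proof -
  obtain V c where "V \<in> F" "c \<in> C" "overlap S V" "outer S = lca S V" "cor c (hat S (lca S V)) \<in> V"
    using outer_in[OF assms] unfolding genuine_def by blast
  then show ?thesis using that by simp
qed

text \<open>\<open>M\<close> lies between \<open>S\<close> and the hat of \<open>S\<close> below
  \<open>outer S\<close>. Hence \<open>heredity\<close> moves the corner in the wall from the hat to
  \<open>M\<close>, and \<open>overlap_up\<close> keeps the least common container.\<close>

lemma outer_solid:
  assumes S: "S \<in> F" "genuine S \<noteq> {}" and M: "M \<in> F" "S \<subseteq> M" "M \<subset> outer S"
  shows "outer S \<in> solid M"
proof -
  obtain V c where V: "V \<in> F" "c \<in> C" "overlap S V" "outer S = lca S V" "cor c (hat S (outer S)) \<in> V"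
    using outer_wall[OF S] .
  have o: "overlap M V" "lca M V = lca S V"
    using overlap_up[of S V M V] S M V lca_psup(2)[of S V] by auto
  have "cor c M \<in> V"
    using heredity[of "hat S (outer S)" M V c] hat_in[OF S(1), of "outer S"] hat_sub[of M S "outer S"]
      M V o(1) by (auto simp: overlap_def)
  then show ?thesis using V o unfolding solid_def by auto
qed

lemma hats:
  assumes "S \<in> F" "Q \<in> F" "overlap S Q"
  defines "N \<equiv> lca S Q"
  shows "hat S N \<in> F" "hat Q N \<in> F" "S \<subseteq> hat S N" "Q \<subseteq> hat Q N" "hat S N \<subset> N" "hat Q N \<subset> N"
    "overlap (hat S N) (hat Q N)" "overlap S (hat Q N)" "lca S (hat Q N) = N"
    "overlap (hat S N) Q" "lca (hat S N) Q = N"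
proof -
  have 1: "hat S N \<in> F" "S \<subseteq> hat S N" "hat S N \<subset> N" "hat Q N \<in> F" "Q \<subseteq> hat Q N" "hat Q N \<subset> N"
    using hat_in[OF assms(1), of N] hat_in[OF assms(2), of N] lca_psup[OF assms(3)] unfolding N_def by auto
  have "S \<subset> N" "Q \<subset> N" using lca_psup[OF assms(3)] unfolding N_def by auto
  with 1 show "hat S N \<in> F" "hat Q N \<in> F" "S \<subseteq> hat S N" "Q \<subseteq> hat Q N" "hat S N \<subset> N" "hat Q N \<subset> N"
    "overlap (hat S N) (hat Q N)" "overlap S (hat Q N)" "lca S (hat Q N) = N"
    "overlap (hat S N) Q" "lca (hat S N) Q = N"
    using overlap_up[OF assms(1-3), folded N_def] assms(1,2) by auto
qed

lemma genuineI:
  assumes "S \<in> F" "Q \<in> F" "overlap S Q" "c \<in> C" "cor c (hat S (lca S Q)) \<in> hat Q (lca S Q)"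
  shows "lca S Q \<in> genuine S"
  using assms hats[OF assms(1-3)] unfolding genuine_def by (auto intro!: exI[of _ "hat Q (lca S Q)"])

text \<open>The two hats overlap, so one has a corner in the other, and that other hat is the
  required wall.\<close>

lemma edge_genuine:
  assumes "S \<in> F" "Q \<in> F" "overlap S Q"
  shows "lca S Q \<in> genuine S \<or> lca S Q \<in> genuine Q"
  using corner[OF hats(1,2,7)[OF assms]] genuineI[OF assms]
    genuineI[OF assms(2,1) overlap_sym[OF assms(3)]] by (auto simp: lca_commute)

text \<open>Incomparable members through the same corner of \<open>A\<close> form a clique.
  Orienting each overlap from a member whose corner lies in the other one bounds the outdegree by
  \<open>card C * w\<close>.\<close>

lemma colb_antichain:
  assumes D: "D \<subseteq> F" and anti: "\<And>A B. A \<in> D \<Longrightarrow> B \<in> D \<Longrightarrow> \<not> A \<subset> B"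
  shows "colb D overlap (2 * (card C * w) + 1)"
proof (rule colb_outdegree[where out="\<lambda>A. {B\<in>D. overlap A B \<and> (\<exists>c\<in>C. cor c A \<in> B)}"])
  show "finite D" using D fin by (rule finite_subset)
next
  fix A assume "A \<in> D"
  define out where "out c = {B\<in>D. overlap A B \<and> cor c A \<in> B}" for c
  have "card (out c) \<le> w" for c
    by (rule cliques_leD[OF cliq]) (use D anti in \<open>auto simp: out_def overlap_def\<close>)
  then have "card (\<Union>c\<in>C. out c) \<le> card C * w"
    using card_UN_le[OF finC, of out] sum_bounded_above[of C "\<lambda>c. card (out c)" w] by fastforce
  moreover have "{B\<in>D. overlap A B \<and> (\<exists>c\<in>C. cor c A \<in> B)} \<inter> D = (\<Union>c\<in>C. out c)"
    by (auto simp: out_def)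
  ultimately show "card ({B\<in>D. overlap A B \<and> (\<exists>c\<in>C. cor c A \<in> B)} \<inter> D) \<le> card C * w" by simp
next
  fix A B assume "A \<in> D" "B \<in> D" "overlap A B"
  then show "A \<noteq> B \<and> (B \<in> {B\<in>D. overlap A B \<and> (\<exists>c\<in>C. cor c A \<in> B)} \<or>
      A \<in> {A\<in>D. overlap B A \<and> (\<exists>c\<in>C. cor c B \<in> A)})"
    using corner[of A B] D overlap_sym[of A B] overlap_irrefl[of A] by auto
qed

section \<open>Node colourings and the separation into classes\<close>

definition parent :: "'a set \<Rightarrow> 'a set" where
  "parent A = \<Inter>{X\<in>F. A \<subset> X}"

lemma parent_hat:
  assumes "S \<in> F" "N \<in> F" "S \<subset> N"
  shows "parent (hat S N) = N"
proof -
  note h = hat_in[OF assms(1,3)]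
  have "N \<subseteq> X" if "X \<in> F" "hat S N \<subset> X" for X
    using containers_chain[OF assms(1) that(1) assms(2)] that h hat_sub[OF that(1), of S N] by blast
  then show ?thesis using h assms(2) unfolding parent_def by blast
qed

text \<open>Siblings form an antichain, since \<open>A \<subset> B\<close> gives
  \<open>parent A \<subseteq> B \<subset> parent B\<close>. \<open>Om\<close> is left out because
  its \<open>parent\<close> is an intersection over no member.\<close>

lemma colb_siblings: "colb (F - {Om}) (\<lambda>A B. overlap A B \<and> parent A = parent B) (2 * (card C * w) + 1)"
proof (rule colb_blocks[where h=parent])
  fix b
  show "colb {x \<in> F - {Om}. parent x = b} (\<lambda>A B. overlap A B \<and> parent A = parent B)
      (2 * (card C * w) + 1)"
  proof (rule colb_mono[OF colb_antichain])
    fix A B assume AB: "A \<in> {x \<in> F - {Om}. parent x = b}" "B \<in> {x \<in> F - {Om}. parent x = b}"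
    have "Om \<in> {X\<in>F. B \<subset> X}" using AB root below_root[of B] by auto
    then have "{X\<in>F. B \<subset> X} \<noteq> {}" by blast
    then have "parent B \<in> {X\<in>F. B \<subset> X}"
      unfolding parent_def using AB fin containers_chain[of B] by (intro chain_least) auto
    then show "\<not> A \<subset> B" using AB unfolding parent_def by blast
  qed auto
qed auto

text \<open>Each node is directed to the nodes that one or two steps of \<open>solid\<close> reach.
  By \<open>card_solid\<close> there are at most \<open>m + m\<^sup>2\<close> of them, and
  \<open>colb_outdegree\<close> applies.\<close>

lemma ex_node_coloring:
  obtains \<psi> :: "'a set \<Rightarrow> nat" where
    "\<And>A. A \<in> F \<Longrightarrow> \<psi> A < 2 * (card C * w + (card C * w)\<^sup>2) + 1"
    "\<And>A B. A \<in> F \<Longrightarrow> B \<in> solid A \<Longrightarrow> \<psi> A \<noteq> \<psi> B"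
    "\<And>A L B. A \<in> F \<Longrightarrow> L \<in> solid A \<Longrightarrow> B \<in> solid L \<Longrightarrow> \<psi> A \<noteq> \<psi> B"
proof -
  define m where "m = card C * w"
  define out where "out A = solid A \<union> (\<Union>L\<in>solid A. solid L)" for A
  have sub: "out A \<subseteq> {X\<in>F. A \<subset> X}" if "A \<in> F" for A
    using solid_sub that unfolding out_def by blast
  have "colb F (\<lambda>A B. B \<in> out A \<or> A \<in> out B) (2 * (m + m\<^sup>2) + 1)"
  proof (rule colb_outdegree[OF fin, where out=out])
    fix A assume A: "A \<in> F"
    have fs: "finite (solid A)" using solid_sub[OF A] fin by (auto intro: finite_subset)
    have "card (out A) \<le> card (solid A) + card (\<Union>L\<in>solid A. solid L)"
      unfolding out_def by (rule card_Un_le)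
    also have "card (\<Union>L\<in>solid A. solid L) \<le> (\<Sum>L\<in>solid A. card (solid L))" by (rule card_UN_le[OF fs])
    also have "\<dots> \<le> card (solid A) * m"
      using sum_bounded_above[of "solid A" "\<lambda>L. card (solid L)" m] card_solid solid_sub[OF A]
      unfolding m_def by fastforce
    also have "\<dots> \<le> m * m" using card_solid[OF A] unfolding m_def by (intro mult_right_mono) auto
    finally have "card (out A) \<le> m + m\<^sup>2" using card_solid[OF A] unfolding m_def power2_eq_square by linarith
    moreover have "card (out A \<inter> F) \<le> card (out A)"
      by (rule card_mono) (use sub[OF A] fin in \<open>auto intro: finite_subset\<close>)
    ultimately show "card (out A \<inter> F) \<le> m + m\<^sup>2" by linarith
  next
    fix A B assume "A \<in> F" "B \<in> F" "B \<in> out A \<or> A \<in> out B"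
    then show "A \<noteq> B \<and> (B \<in> out A \<or> A \<in> out B)" using sub by blast
  qed
  then obtain f where f: "\<forall>x\<in>F. f x < 2 * (m + m\<^sup>2) + 1"
     "\<forall>x\<in>F. \<forall>y\<in>F. (y \<in> out x \<or> x \<in> out y) \<longrightarrow> f x \<noteq> f y" by (rule colbE)
  show ?thesis
  proof (rule that[of f])
    fix A B assume A: "A \<in> F"
    show "f A < 2 * (card C * w + (card C * w)\<^sup>2) + 1" using f A unfolding m_def by blast
    have out: "f A \<noteq> f B" if "B \<in> out A" using f(2) sub[OF A] A that by blast
    show "f A \<noteq> f B" if "B \<in> solid A" using out that unfolding out_def by blast
    show "f A \<noteq> f B" if "L \<in> solid A" "B \<in> solid L" for L using out that unfolding out_def by blast
  qed
qed

text \<open>A class fixes the node colour of \<open>outer S\<close> and the sibling colour of the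
  hat below it. If \<open>lca S Q\<close> lies below both outer nodes, these coincide and then so do
  the hats. Otherwise exactly one outer node is strictly inside \<open>lca S Q\<close>.\<close>

lemma separation:
  obtains g :: "'a set \<Rightarrow> bool \<times> nat \<times> nat" where
    "\<And>S. S \<in> F \<Longrightarrow>
       g S \<in> UNIV \<times> {..<2 * (card C * w + (card C * w)\<^sup>2) + 1} \<times> {..<2 * (card C * w) + 1}"
    "\<And>S. S \<in> F \<Longrightarrow> fst (g S) \<longleftrightarrow> genuine S \<noteq> {}"
    "\<And>S Q. S \<in> F \<Longrightarrow> Q \<in> F \<Longrightarrow> genuine S \<noteq> {} \<Longrightarrow> genuine Q \<noteq> {} \<Longrightarrow> g S = g Q \<Longrightarrow>
       outer S \<notin> solid (outer Q) \<and> (\<forall>L\<in>solid (outer Q). outer S \<notin> solid L)"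
    "\<And>S Q. S \<in> F \<Longrightarrow> Q \<in> F \<Longrightarrow> overlap S Q \<Longrightarrow> g S = g Q \<Longrightarrow> hat S (outer S) = hat Q (outer Q) \<or>
       lca S Q \<subseteq> outer S \<and> outer Q \<subset> lca S Q \<or> lca S Q \<subseteq> outer Q \<and> outer S \<subset> lca S Q"
proof -
  obtain \<psi> :: "'a set \<Rightarrow> nat" where psi: "\<And>A. A \<in> F \<Longrightarrow> \<psi> A < 2 * (card C * w + (card C * w)\<^sup>2) + 1"
    "\<And>A B. A \<in> F \<Longrightarrow> B \<in> solid A \<Longrightarrow> \<psi> A \<noteq> \<psi> B"
    "\<And>A L B. A \<in> F \<Longrightarrow> L \<in> solid A \<Longrightarrow> B \<in> solid L \<Longrightarrow> \<psi> A \<noteq> \<psi> B"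
    using ex_node_coloring by blast
  obtain \<sigma> where sib: "\<forall>A\<in>F - {Om}. \<sigma> A < 2 * (card C * w) + 1"
    "\<forall>A\<in>F - {Om}. \<forall>B\<in>F - {Om}. overlap A B \<and> parent A = parent B \<longrightarrow> \<sigma> A \<noteq> \<sigma> B"
    using colb_siblings by (rule colbE)
  \<comment> \<open>The flag ensures that overlapping members of one class both have a genuine
    container, as \<open>edge_genuine\<close> supplies one for only one side.\<close>
  define g where "g S = (if genuine S = {} then (False, 0, 0)
    else (True, \<psi> (outer S), \<sigma> (hat S (outer S))))" for S
  have hatO: "hat S (outer S) \<in> F - {Om}" if "S \<in> F" "genuine S \<noteq> {}" for S
    using hat_in[of S "outer S"] outer_F[OF that] that below_root by blast
  have gE: "genuine S \<noteq> {} \<and> genuine Q \<noteq> {}"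
    if "S \<in> F" "Q \<in> F" "overlap S Q" "g S = g Q" for S Q
    using edge_genuine[OF that(1-3)] that(4) unfolding g_def by (auto split: if_splits)
  show ?thesis
  proof (rule that[of g])
    fix S assume "S \<in> F"
    then show "g S \<in> UNIV \<times> {..<2 * (card C * w + (card C * w)\<^sup>2) + 1} \<times> {..<2 * (card C * w) + 1}"
      using psi(1)[of "outer S"] outer_F[of S] sib(1) hatO[of S] unfolding g_def by auto
  next
    fix S Q assume *: "S \<in> F" "Q \<in> F" "genuine S \<noteq> {}" "genuine Q \<noteq> {}" "g S = g Q"
    then have "outer Q \<in> F" "\<psi> (outer Q) = \<psi> (outer S)" using outer_F[of Q] unfolding g_def by auto
    then show "outer S \<notin> solid (outer Q) \<and> (\<forall>L\<in>solid (outer Q). outer S \<notin> solid L)"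
      using psi(2,3)[of "outer Q"] by blast
  next
    fix S Q assume SQ: "S \<in> F" "Q \<in> F" "overlap S Q" and eq: "g S = g Q"
    note ne = gE[OF SQ eq]
    have oS: "outer S \<in> F" "S \<subset> outer S" and oQ: "outer Q \<in> F" "Q \<subset> outer Q"
      using outer_F SQ ne by blast+
    have psieq: "\<psi> (outer S) = \<psi> (outer Q)" and sibeq: "\<sigma> (hat S (outer S)) = \<sigma> (hat Q (outer Q))"
      using eq ne unfolding g_def by auto
    define N where "N = lca S Q"
    have N: "N \<in> F" "S \<subseteq> N" "Q \<subseteq> N" using lca_in lca_sup SQ unfolding N_def by blast+
    have cS: "N \<subseteq> outer S \<or> outer S \<subset> N" and cQ: "N \<subseteq> outer Q \<or> outer Q \<subset> N"
      using containers_chain[OF SQ(1) N(1) oS(1)] containers_chain[OF SQ(2) N(1) oQ(1)] N oS oQ by blast+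
    have some: "N \<subseteq> outer S \<or> N \<subseteq> outer Q"
      using edge_genuine[OF SQ] outer_ge unfolding N_def by blast
    have "hat S (outer S) = hat Q (outer Q)" if both: "N \<subseteq> outer S" "N \<subseteq> outer Q"
    proof -
      \<comment> \<open>From \<open>B \<subseteq> outer A \<subset> outer B\<close> it would follow
        that \<open>outer B\<close> is in \<open>solid (outer A)\<close>, but \<psi> separates
        these.\<close>
      have no: "\<not> outer A \<subset> outer B" if "A \<in> F" "B \<in> F" "genuine A \<noteq> {}" "genuine B \<noteq> {}"
        "\<psi> (outer A) = \<psi> (outer B)" "B \<subseteq> outer A" for A B
        using outer_solid[of B "outer A"] psi(2)[of "outer A" "outer B"] outer_F[of A] that by blast
      have "outer S \<subseteq> outer Q \<or> outer Q \<subseteq> outer S"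
        using containers_chain[OF SQ(1) oS(1) oQ(1)] both N oS by blast
      moreover have "S \<subseteq> outer Q" "Q \<subseteq> outer S" using both N by blast+
      then have "\<not> outer S \<subset> outer Q" "\<not> outer Q \<subset> outer S"
        using no[OF SQ(1,2)] no[OF SQ(2,1)] ne psieq by simp_all
      ultimately have same: "outer S = outer Q" by (simp add: psubset_eq) blast
      show ?thesis
      proof (rule ccontr)
        assume neq: "\<not> ?thesis"
        have par: "parent (hat S (outer S)) = parent (hat Q (outer Q))"
          using parent_hat SQ oS oQ same by metis
        note hS = hat_in[OF SQ(1) oS(2)] and hQ = hat_in[OF SQ(2) oQ(2)]
        \<comment> \<open>Distinct children of the same node are incomparable. These two meet, so
          they would overlap and \<sigma> would separate them.\<close>
        have "\<not> hat S (outer S) \<subseteq> hat Q (outer Q)"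
          using hat_sub[of "hat Q (outer Q)" S "outer S"] hS hQ same neq by blast
        moreover have "\<not> hat Q (outer Q) \<subseteq> hat S (outer S)"
          using hat_sub[of "hat S (outer S)" Q "outer Q"] hS hQ same neq by blast
        ultimately have "overlap (hat S (outer S)) (hat Q (outer Q))"
          using hS hQ SQ(3) unfolding overlap_def by blast
        then show False using sib(2) hatO SQ ne par sibeq by metis
      qed
    qed
    then show "hat S (outer S) = hat Q (outer Q) \<or>
       lca S Q \<subseteq> outer S \<and> outer Q \<subset> lca S Q \<or> lca S Q \<subseteq> outer Q \<and> outer S \<subset> lca S Q"
      using cS cQ some unfolding N_def by blast
  qed (simp add: g_def)
qed

definition sep_const :: nat where
  "sep_const = 2 * ((2 * (card C * w + (card C * w)\<^sup>2) + 1) * (2 * (card C * w) + 1))"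

lemma colb_separation:
  assumes q: "0 < q"
    and step: "\<And>D. D \<subseteq> F \<Longrightarrow> (\<And>S. S \<in> D \<Longrightarrow> genuine S \<noteq> {}) \<Longrightarrow>
      (\<And>S Q. S \<in> D \<Longrightarrow> Q \<in> D \<Longrightarrow>
         outer S \<notin> solid (outer Q) \<and> (\<forall>L\<in>solid (outer Q). outer S \<notin> solid L)) \<Longrightarrow>
      (\<And>S Q. S \<in> D \<Longrightarrow> Q \<in> D \<Longrightarrow> overlap S Q \<Longrightarrow> hat S (outer S) = hat Q (outer Q) \<or>
         lca S Q \<subseteq> outer S \<and> outer Q \<subset> lca S Q \<or> lca S Q \<subseteq> outer Q \<and> outer S \<subset> lca S Q) \<Longrightarrow>
      colb D overlap q"
  shows "colb F overlap (sep_const * q)"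
proof (rule separation)
  fix g :: "'a set \<Rightarrow> bool \<times> nat \<times> nat"
  assume g: "\<And>S. S \<in> F \<Longrightarrow>
       g S \<in> UNIV \<times> {..<2 * (card C * w + (card C * w)\<^sup>2) + 1} \<times> {..<2 * (card C * w) + 1}"
    "\<And>S. S \<in> F \<Longrightarrow> fst (g S) \<longleftrightarrow> genuine S \<noteq> {}"
    "\<And>S Q. S \<in> F \<Longrightarrow> Q \<in> F \<Longrightarrow> genuine S \<noteq> {} \<Longrightarrow> genuine Q \<noteq> {} \<Longrightarrow> g S = g Q \<Longrightarrow>
       outer S \<notin> solid (outer Q) \<and> (\<forall>L\<in>solid (outer Q). outer S \<notin> solid L)"
    "\<And>S Q. S \<in> F \<Longrightarrow> Q \<in> F \<Longrightarrow> overlap S Q \<Longrightarrow> g S = g Q \<Longrightarrow> hat S (outer S) = hat Q (outer Q) \<or>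
       lca S Q \<subseteq> outer S \<and> outer Q \<subset> lca S Q \<or> lca S Q \<subseteq> outer Q \<and> outer S \<subset> lca S Q"
  show ?thesis
  proof (rule colb_split_finite[where g=g and A="UNIV \<times>
      {..<2 * (card C * w + (card C * w)\<^sup>2) + 1} \<times> {..<2 * (card C * w) + 1}"])
    fix a
    show "colb {S\<in>F. g S = a} overlap q"
    proof (cases "fst a")
      case True
      then have gen: "genuine S \<noteq> {}" if "S \<in> F" "g S = a" for S using g(2) that by blast
      show ?thesis
      proof (rule step)
        fix S Q assume "S \<in> {S\<in>F. g S = a}" "Q \<in> {S\<in>F. g S = a}"
        then have "S \<in> F" "Q \<in> F" "g S = g Q" "genuine S \<noteq> {}" "genuine Q \<noteq> {}" using gen by auto
        then show "outer S \<notin> solid (outer Q) \<and> (\<forall>L\<in>solid (outer Q). outer S \<notin> solid L)"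
          "overlap S Q \<Longrightarrow> hat S (outer S) = hat Q (outer Q) \<or>
           lca S Q \<subseteq> outer S \<and> outer Q \<subset> lca S Q \<or> lca S Q \<subseteq> outer Q \<and> outer S \<subset> lca S Q"
          using g(3)[of S Q] g(4)[of S Q] by blast+
      next
        show "genuine S \<noteq> {}" if "S \<in> {S\<in>F. g S = a}" for S using that gen by blast
      qed blast
    next
      case False
      then have "genuine S = {}" if "S \<in> F" "g S = a" for S using g(2) that by blast
      then show ?thesis using edge_genuine q by (intro colb_indep) blast+
    qed
  qed (use g(1) in \<open>auto simp: sep_const_def card_cartesian_product simp del: mult_Suc_right\<close>)
qed

text \<open>Walls through a corner of \<open>Z\<close> are replaced by maximal ones, of which there are few.\<close>

lemma ex_wall_keys:
  assumes D: "\<And>X. X \<in> D \<Longrightarrow> X \<in> F \<and> Z X \<in> F \<and> X \<subseteq> Z X \<and>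
      (\<exists>V\<in>F. \<exists>c\<in>C. overlap (Z X) V \<and> cor c (Z X) \<in> V \<and> V \<inter> X \<noteq> {})"
  obtains W c and key :: "'a set \<Rightarrow> nat" where
    "\<And>X. X \<in> D \<Longrightarrow> W X \<in> F \<and> c X \<in> C \<and> overlap (Z X) (W X) \<and> cor (c X) (Z X) \<in> W X \<and>
        W X \<inter> X \<noteq> {} \<and> \<not> X \<subseteq> W X \<and> key X < card C * w"
    "\<And>X Y. X \<in> D \<Longrightarrow> Y \<in> D \<Longrightarrow> Z X = Z Y \<Longrightarrow> key X = key Y \<Longrightarrow> W X = W Y \<and> c X = c Y"
proof -
  define cand where "cand A c = {V\<in>F. overlap A V \<and> cor c A \<in> V}" for A c
  define mx where "mx A c = {V\<in>cand A c. \<forall>V'\<in>cand A c. V \<subseteq> V' \<longrightarrow> V = V'}" for A c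
  define T where "T A = (SIGMA c:C. mx A c)" for A
  have mxF: "mx A c \<subseteq> F" for A c unfolding mx_def cand_def by blast
  \<comment> \<open>Maximal candidates are incomparable and all contain \<open>cor c A\<close>, so
    they form a clique.\<close>
  have card_mx: "card (mx A c) \<le> w" for A c
  proof (rule cliques_leD[OF cliq mxF])
    fix V V' assume V: "V \<in> mx A c" "V' \<in> mx A c" "V \<noteq> V'"
    then have "\<not> V \<subseteq> V'" "\<not> V' \<subseteq> V" "cor c A \<in> V \<inter> V'" unfolding mx_def cand_def by simp_all blast+
    then show "overlap V V'" unfolding overlap_def by blast
  qed
  have finT: "finite (T A)" for A
    unfolding T_def using finC finite_subset[OF mxF fin] by (intro finite_SigmaI)
  have "card (T A) \<le> card C * w" for A
  proof -
    have "card (T A) = (\<Sum>c\<in>C. card (mx A c))"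
      unfolding T_def using finC finite_subset[OF mxF fin] by (intro card_SigmaI) auto
    also have "\<dots> \<le> card C * w"
      using sum_bounded_above[of C "\<lambda>c. card (mx A c)" w] card_mx by simp
    finally show ?thesis .
  qed
  have "\<exists>e. \<forall>A. inj_on (e A) (T A) \<and> e A ` T A = {..<card (T A)}"
  proof (rule choice, rule)
    fix A
    obtain e where "bij_betw e (T A) {0..<card (T A)}" using ex_bij_betw_finite_nat[OF finT] by blast
    then show "\<exists>e. inj_on e (T A) \<and> e ` T A = {..<card (T A)}"
      by (auto simp: bij_betw_def atLeast0LessThan)
  qed
  then obtain e where e: "\<forall>A. inj_on (e A) (T A) \<and> e A ` T A = {..<card (T A)}" by blast
  have e_less: "e A p < card C * w" if "p \<in> T A" for A p
  proof -
    have "e A p \<in> {..<card (T A)}" using e that by blast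
    then show ?thesis using \<open>\<And>A. card (T A) \<le> card C * w\<close>[of A] by simp
  qed
  have "\<forall>X. \<exists>p. X \<in> D \<longrightarrow> p \<in> T (Z X) \<and> snd p \<inter> X \<noteq> {}"
  proof
    fix X
    show "\<exists>p. X \<in> D \<longrightarrow> p \<in> T (Z X) \<and> snd p \<inter> X \<noteq> {}"
    proof (cases "X \<in> D")
      case True
      then have "\<exists>V\<in>F. \<exists>c\<in>C. overlap (Z X) V \<and> cor c (Z X) \<in> V \<and> V \<inter> X \<noteq> {}" using D by simp
      then obtain V c where V: "V \<in> F" "c \<in> C" "overlap (Z X) V" "cor c (Z X) \<in> V" "V \<inter> X \<noteq> {}"
        by blast
      then have "V \<in> cand (Z X) c" "finite (cand (Z X) c)" using fin unfolding cand_def by auto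
      then obtain V' where "V' \<in> cand (Z X) c" "V \<subseteq> V'" "\<forall>U\<in>cand (Z X) c. V' \<subseteq> U \<longrightarrow> V' = U"
        using finite_has_maximal2[of "cand (Z X) c" V] by blast
      then have "(c, V') \<in> T (Z X) \<and> snd (c, V') \<inter> X \<noteq> {}"
        using V unfolding T_def mx_def by auto
      then show ?thesis by blast
    qed auto
  qed
  from choice[OF this] obtain p where p: "\<And>X. X \<in> D \<Longrightarrow> p X \<in> T (Z X) \<and> snd (p X) \<inter> X \<noteq> {}"
    by blast
  show ?thesis
  proof (rule that[of "\<lambda>X. snd (p X)" "\<lambda>X. fst (p X)" "\<lambda>X. e (Z X) (p X)"])
    fix X assume X: "X \<in> D"
    have 1: "snd (p X) \<in> F \<and> fst (p X) \<in> C \<and> overlap (Z X) (snd (p X)) \<and> cor (fst (p X)) (Z X) \<in> snd (p X)"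
      using p[OF X] unfolding T_def mx_def cand_def by auto
    then have "\<not> X \<subseteq> snd (p X)" using clean_familyD[OF clean _ _ _ _, of "Z X" "snd (p X)" X] D[OF X] by blast
    with 1 show "snd (p X) \<in> F \<and> fst (p X) \<in> C \<and> overlap (Z X) (snd (p X)) \<and>
        cor (fst (p X)) (Z X) \<in> snd (p X) \<and> snd (p X) \<inter> X \<noteq> {} \<and> \<not> X \<subseteq> snd (p X) \<and>
        e (Z X) (p X) < card C * w"
      using p[OF X] e_less by blast
  next
    fix X Y assume "X \<in> D" "Y \<in> D" "Z X = Z Y" "e (Z X) (p X) = e (Z Y) (p Y)"
    then have "p X = p Y" using p e by (metis inj_onD)
    then show "snd (p X) = snd (p Y) \<and> fst (p X) = fst (p Y)" by simp
  qed
qed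

text \<open>Fixing the key and \<open>Z\<close> leaves parts of one \<open>A\<close> that meet one
  wall \<open>V\<close> through a corner of \<open>A\<close> without lying in \<open>V\<close>. They
  all cross the boundary of \<open>V\<close>, which gives \<open>step\<close> a common point or line
  to work with.\<close>

lemma colb_walls:
  assumes D: "\<And>X. X \<in> D \<Longrightarrow> X \<in> F \<and> Z X \<in> F \<and> X \<subseteq> Z X \<and>
      (\<exists>V\<in>F. \<exists>c\<in>C. overlap (Z X) V \<and> cor c (Z X) \<in> V \<and> V \<inter> X \<noteq> {})"
    and step: "\<And>D' V c A. D' \<subseteq> D \<Longrightarrow> V \<in> F \<Longrightarrow> c \<in> C \<Longrightarrow> A \<in> F \<Longrightarrow> cor c A \<in> V \<Longrightarrow>
      (\<And>X. X \<in> D' \<Longrightarrow> X \<subseteq> A \<and> V \<inter> X \<noteq> {} \<and> \<not> X \<subseteq> V) \<Longrightarrow> colb D' overlap q"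
  shows "colb D (\<lambda>X Y. overlap X Y \<and> Z X = Z Y) (card C * w * q)"
proof (rule ex_wall_keys[of D Z, OF D])
  fix W c and key :: "'a set \<Rightarrow> nat"
  assume W: "\<And>X. X \<in> D \<Longrightarrow> W X \<in> F \<and> c X \<in> C \<and> overlap (Z X) (W X) \<and> cor (c X) (Z X) \<in> W X \<and>
        W X \<inter> X \<noteq> {} \<and> \<not> X \<subseteq> W X \<and> key X < card C * w"
    and same: "\<And>X Y. X \<in> D \<Longrightarrow> Y \<in> D \<Longrightarrow> Z X = Z Y \<Longrightarrow> key X = key Y \<Longrightarrow> W X = W Y \<and> c X = c Y"
  show ?thesis
  proof (rule colb_split[where g=key])
    show "key X < card C * w" if "X \<in> D" for X using W[OF that] by simp
    fix i
    show "colb {X\<in>D. key X = i} (\<lambda>X Y. overlap X Y \<and> Z X = Z Y) q"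
    proof (rule colb_blocks[where h=Z])
      fix A
      define D' where "D' = {X\<in>{X\<in>D. key X = i}. Z X = A}"
      have "colb D' overlap q"
      proof (cases "D' = {}")
        case True
        then show ?thesis by (auto intro: colbI)
      next
        case False
        then obtain X0 where X0: "X0 \<in> D'" by blast
        then have X0D: "X0 \<in> D" "Z X0 = A" "key X0 = i" unfolding D'_def by auto
        show ?thesis
        proof (rule step[of D' "W X0" "c X0" A])
          show "D' \<subseteq> D" unfolding D'_def by blast
          fix X assume "X \<in> D'"
          then have X: "X \<in> D" "Z X = A" "key X = i" unfolding D'_def by auto
          then have "W X = W X0" using same[OF X(1) X0D(1)] X0D by simp
          then show "X \<subseteq> A \<and> W X0 \<inter> X \<noteq> {} \<and> \<not> X \<subseteq> W X0"
            using W[OF X(1)] D[OF X(1)] X(2) by simp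
        qed (use W[OF X0D(1)] D[OF X0D(1)] X0D in auto)
      qed
      then show "colb {X\<in>{X\<in>D. key X = i}. Z X = A} (\<lambda>X Y. overlap X Y \<and> Z X = Z Y) q"
        unfolding D'_def by (rule colb_mono) auto
    qed simp
  qed
qed

text \<open>Makes \<open>colb_walls\<close> applicable with \<open>Z X = hat X (outer X)\<close>,
  which settles the first alternative of \<open>separation\<close>.\<close>

lemma outer_wall_hat:
  assumes "S \<in> F" "genuine S \<noteq> {}"
  shows "hat S (outer S) \<in> F \<and> S \<subseteq> hat S (outer S) \<and> (\<exists>V\<in>F. \<exists>c\<in>C.
      overlap (hat S (outer S)) V \<and> cor c (hat S (outer S)) \<in> V \<and> V \<inter> S \<noteq> {})"
proof -
  obtain V c where V: "V \<in> F" "c \<in> C" "overlap S V" "outer S = lca S V" "cor c (hat S (outer S)) \<in> V"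
    using outer_wall[OF assms] .
  have "V \<inter> S \<noteq> {}" using V(3) unfolding overlap_def by blast
  then show ?thesis using V hats(1,3,10)[OF assms(1) V(1,3)] by auto
qed

end

section \<open>Intervals\<close>

text \<open>\<open>sep_const\<close> for two end points, times the \<open>2 * w * w\<close> colours
  spent inside one class of the separation.\<close>

definition interval_const :: "nat \<Rightarrow> nat" where
  "interval_const w = 2 * ((2 * (2 * w + (2 * w)\<^sup>2) + 1) * (2 * (2 * w) + 1)) * (2 * w * w)"

text \<open>Each of two overlapping intervals has an end point in the other, so
  \<open>lca S Q\<close> is genuine for both and only overlaps inside a common hat survive the
  separation. Members at a common wall share a point; there, ordering by both end points has cliques
  as chains.\<close>

lemma colb_intervals:
  fixes I :: "real set set"
  assumes fin: "finite I" and int: "\<And>A. A \<in> I \<Longrightarrow> A = {Inf A..Sup A} \<and> Inf A \<le> Sup A"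
    and clean: "clean_family I" and cliq: "cliques_le I w"
  shows "colb I overlap (interval_const w)"
proof (cases "I = {}")
  case True
  then show ?thesis by (auto intro: colbI)
next
  case False
  then obtain A0 where A0: "A0 \<in> I" by blast
  have w: "0 < w" using cliques_leD[OF cliq, of "{A0}"] A0 by simp
  define m M where "m = Min (Inf ` I)" and "M = Max (Sup ` I)"
  have mM: "m \<le> Inf A" "Sup A \<le> M" if "A \<in> I" for A
    using that fin unfolding m_def M_def by auto
  \<comment> \<open>The hull of the family serves as root; containing every member, it overlaps
    none.\<close>
  define Om where "Om = {m..M}"
  define F where "F = insert Om I"
  have mleM: "m \<le> M" using mM[OF A0] int[OF A0] by linarith
  have sub: "A \<subseteq> Om" if "A \<in> F" for A
  proof (cases "A = Om")
    case False
    then have "A \<in> I" using that unfolding F_def by blast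
    then show ?thesis using int[of A] mM[of A] unfolding Om_def by (metis atLeastatMost_subset_iff)
  qed simp
  have intF: "A = {Inf A..Sup A} \<and> Inf A \<le> Sup A" if "A \<in> F" for A
    using that int mleM unfolding F_def Om_def by auto
  have no: "\<not> overlap A Om" "\<not> overlap Om A" if "A \<in> F" for A
    using sub[OF that] unfolding overlap_def by blast+
  have sE: "A \<subseteq> B \<longleftrightarrow> Inf B \<le> Inf A \<and> Sup A \<le> Sup B" if "A \<in> F" "B \<in> F" for A B
    using intF[OF that(1)] intF[OF that(2)] by (metis atLeastatMost_subset_iff)
  have mem: "x \<in> A \<longleftrightarrow> Inf A \<le> x \<and> x \<le> Sup A" if "A \<in> F" for A x
    using intF[OF that] by (metis atLeastAtMost_iff)
  define cor where "cor c A = (if c then Inf A else Sup A)" for c and A :: "real set"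
  have endp: "Inf A \<le> Inf B \<and> Inf B \<le> Sup A \<and> Inf B \<le> Sup A \<and> Sup A \<le> Sup B \<or>
      Inf B \<le> Inf A \<and> Inf A \<le> Sup B \<and> Sup B \<le> Sup A" if AB: "A \<in> F" "B \<in> F" "overlap A B" for A B
  proof -
    obtain x where "x \<in> A" "x \<in> B" using AB(3) unfolding overlap_def by blast
    moreover have "\<not> A \<subseteq> B" "\<not> B \<subseteq> A" using AB(3) unfolding overlap_def by blast+
    ultimately show ?thesis using mem[OF AB(1), of x] mem[OF AB(2), of x] sE[OF AB(1,2)] sE[OF AB(2,1)]
      by linarith
  qed
  interpret corner_family F w "UNIV :: bool set" cor Om
  proof
    show "finite F" using fin unfolding F_def by simp
    show "A \<noteq> {}" if "A \<in> F" for A using intF[OF that] by (metis atLeastatMost_empty_iff2)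
    show "clean_family F" unfolding clean_family_def
    proof clarify
      fix A B S assume *: "A \<in> F" "B \<in> F" "S \<in> F" "overlap A B" "S \<subseteq> A" "S \<subseteq> B"
      then have "A \<noteq> Om" "B \<noteq> Om" using no by blast+
      then have AB: "A \<in> I" "B \<in> I" using * unfolding F_def by blast+
      have "S \<noteq> Om"
      proof
        assume "S = Om"
        then have "A = Om" using sub[OF *(1)] *(5) by blast
        then show False using \<open>A \<noteq> Om\<close> by simp
      qed
      then have "S \<in> I" using * unfolding F_def by blast
      then show False using clean_familyD[OF clean AB _ *(4-6)] by blast
    qed
    show "cliques_le F w" unfolding cliques_le_def
    proof (intro allI impI)
      fix K assume K: "K \<subseteq> F" "\<forall>A\<in>K. \<forall>B\<in>K. A \<noteq> B \<longrightarrow> overlap A B"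
      show "card K \<le> w"
      proof (cases "Om \<in> K")
        case True
        then have "K = {Om}" using K no by blast
        then show ?thesis using w by simp
      next
        case False
        then have "K \<subseteq> I" using K(1) unfolding F_def by blast
        then show ?thesis using cliques_leD[OF cliq] K(2) by simp
      qed
    qed
    fix Z S V and c :: bool assume *: "Z \<in> F" "S \<in> F" "V \<in> F" "S \<subseteq> Z" "cor c Z \<in> V" "V \<inter> S \<noteq> {}"
    then obtain x where "x \<in> V" "x \<in> S" by blast
    then show "cor c S \<in> V"
      using * mem[OF *(3)] mem[OF *(2), of x] sE[OF *(2,1)] unfolding cor_def
      by (cases c) (auto intro: order_trans)
  next
    fix A B assume *: "A \<in> F" "B \<in> F" "overlap A B"
    then show "\<exists>c\<in>UNIV. cor c A \<in> B \<or> cor c B \<in> A"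
      using endp[OF *] mem[OF *(1)] mem[OF *(2)] unfolding cor_def by (metis UNIV_I)
  qed (use sub in \<open>auto simp: F_def\<close>)
  have both: "lca S Q \<in> genuine S" if SQ: "S \<in> F" "Q \<in> F" "overlap S Q" for S Q
  proof -
    note h = hats[OF SQ]
    have "\<exists>c. cor c (hat S (lca S Q)) \<in> hat Q (lca S Q)"
      using endp[OF h(1,2,7)] mem[OF h(2)] unfolding cor_def by (metis (full_types))
    then show ?thesis using genuineI[OF SQ] by blast
  qed
  have "colb F overlap (sep_const * (2 * w * w))"
  proof (rule colb_separation)
    fix D
    assume D: "D \<subseteq> F" "\<And>S. S \<in> D \<Longrightarrow> genuine S \<noteq> {}"
      and cases: "\<And>S Q. S \<in> D \<Longrightarrow> Q \<in> D \<Longrightarrow> overlap S Q \<Longrightarrow> hat S (outer S) = hat Q (outer Q) \<or>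
         lca S Q \<subseteq> outer S \<and> outer Q \<subset> lca S Q \<or> lca S Q \<subseteq> outer Q \<and> outer S \<subset> lca S Q"
    have eq: "hat S (outer S) = hat Q (outer Q)" if "S \<in> D" "Q \<in> D" "overlap S Q" for S Q
    proof -
      have "lca S Q \<subseteq> outer S" "lca S Q \<subseteq> outer Q"
        using both[of S Q] both[of Q S] that(1,2) D(1) outer_ge overlap_sym[OF that(3)] that(3)
        by (auto simp: lca_commute[of Q S] subset_iff)
      then show ?thesis using cases[OF that] by blast
    qed
    have "colb D (\<lambda>X Y. overlap X Y \<and> hat X (outer X) = hat Y (outer Y)) (card (UNIV :: bool set) * w * w)"
    proof (rule colb_walls)
      fix X assume "X \<in> D"
      then have XF: "X \<in> F" "genuine X \<noteq> {}" using D by blast+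
      show "X \<in> F \<and> hat X (outer X) \<in> F \<and> X \<subseteq> hat X (outer X) \<and> (\<exists>V\<in>F. \<exists>c\<in>UNIV.
        overlap (hat X (outer X)) V \<and> cor c (hat X (outer X)) \<in> V \<and> V \<inter> X \<noteq> {})"
        by (rule conjI[OF XF(1) outer_wall_hat[OF XF]])
    next
      fix D' V c A
      assume D': "D' \<subseteq> D" and V: "V \<in> F" "A \<in> F" "cor c A \<in> V"
        and X: "\<And>X. X \<in> D' \<Longrightarrow> X \<subseteq> A \<and> V \<inter> X \<noteq> {} \<and> \<not> X \<subseteq> V"
      have D'F: "X \<in> F" if "X \<in> D'" for X using D' D(1) that by blast
      \<comment> \<open>\<open>V\<close> contains the end \<open>c\<close> of \<open>A\<close>, so a
        part of \<open>A\<close> that meets \<open>V\<close> without lying in it leaves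
        \<open>V\<close> at the opposite end.\<close>
      define p where "p = cor (\<not> c) V"
      have pX: "p \<in> X" if XD: "X \<in> D'" for X
      proof -
        obtain x where x: "x \<in> V" "x \<in> X" using X[OF XD] by blast
        show ?thesis
          using X[OF XD] x mem[OF V(1), of x] mem[OF D'F[OF XD]] mem[OF V(1), of "cor c A"] V(3)
            sE[OF D'F[OF XD] V(1)] sE[OF D'F[OF XD] V(2)]
          unfolding p_def cor_def by (cases c) auto
      qed
      show "colb D' overlap w"
      proof (rule colb_mirsky[where R="\<lambda>A B. Inf A < Inf B \<and> Sup A < Sup B"])
        show "finite D'" using D' D(1) \<open>finite I\<close> unfolding F_def by (meson finite.insertI finite_subset)
        fix K assume K: "K \<subseteq> D'" "\<And>x y. x \<in> K \<Longrightarrow> y \<in> K \<Longrightarrow> x \<noteq> y \<Longrightarrow>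
           Inf x < Inf y \<and> Sup x < Sup y \<or> Inf y < Inf x \<and> Sup y < Sup x"
        show "card K \<le> w"
        proof (rule cliques_leD[OF cliq[folded F_def]])
          show "K \<subseteq> F" using K(1) D'F by blast
          fix A B assume AB: "A \<in> K" "B \<in> K" "A \<noteq> B"
          then have D: "A \<in> D'" "B \<in> D'" using K(1) by blast+
          then have "p \<in> A \<inter> B" using pX by simp
          moreover have "\<not> A \<subseteq> B" "\<not> B \<subseteq> A"
            using K(2)[OF AB] sE[OF D'F[OF D(1)] D'F[OF D(2)]] sE[OF D'F[OF D(2)] D'F[OF D(1)]] by linarith+
          ultimately show "overlap A B" unfolding overlap_def by blast
        qed
      next
        fix A B assume AB: "A \<in> D'" "B \<in> D'" "overlap A B"
        then have "A \<in> F" "B \<in> F" "\<not> A \<subseteq> B" "\<not> B \<subseteq> A" using D'F unfolding overlap_def by simp_all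
        then show "Inf A < Inf B \<and> Sup A < Sup B \<or> Inf B < Inf A \<and> Sup B < Sup A"
          using endp[of A B] sE[of A B] sE[of B A] AB(3) by linarith
      qed auto
    qed
    then show "colb D overlap (2 * w * w)"
      by (rule colb_mono) (use eq in auto)
  qed (use w in simp)
  then show ?thesis
    by (rule colb_mono) (auto simp: F_def interval_const_def sep_const_def)
qed

section \<open>Rectangles through a common line\<close>

definition line_const :: "nat \<Rightarrow> nat" where
  "line_const w = w * (w * interval_const w)"

text \<open>Points are accessed only through \<open>px\<close>, \<open>py\<close> and
  \<open>pt\<close>, so that exchanging the axes is just another interpretation
  (\<open>rect_family_swap\<close>).\<close>

locale rect_family =
  fixes F :: "'p set set" and w :: nat and px py :: "'p \<Rightarrow> real" and pt :: "real \<Rightarrow> real \<Rightarrow> 'p"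
    and l r b t :: "'p set \<Rightarrow> real"
  assumes finF: "finite F" and cleanF: "clean_family F" and cliqF: "cliques_le F w"
    and px_pt: "px (pt x y) = x" and py_pt: "py (pt x y) = y"
    and rect: "A \<in> F \<Longrightarrow> A = {p. l A \<le> px p \<and> px p \<le> r A \<and> b A \<le> py p \<and> py p \<le> t A}"
    and lr: "A \<in> F \<Longrightarrow> l A \<le> r A" and bt: "A \<in> F \<Longrightarrow> b A \<le> t A"
begin

text \<open>For overlapping rectangles this is a crossing: \<open>A\<close> traverses
  \<open>B\<close> from bottom to top.\<close>

definition thin :: "'p set \<Rightarrow> 'p set \<Rightarrow> bool" where
  "thin A B \<longleftrightarrow> l B \<le> l A \<and> r A \<le> r B \<and> b A \<le> b B \<and> t B \<le> t A"

lemma in_rect: "A \<in> F \<Longrightarrow> p \<in> A \<longleftrightarrow> l A \<le> px p \<and> px p \<le> r A \<and> b A \<le> py p \<and> py p \<le> t A"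
  using rect[of A] by blast

lemma pt_in: "A \<in> F \<Longrightarrow> pt x y \<in> A \<longleftrightarrow> l A \<le> x \<and> x \<le> r A \<and> b A \<le> y \<and> y \<le> t A"
  by (simp add: in_rect px_pt py_pt)

lemma rect_subset:
  assumes "A \<in> F" "B \<in> F"
  shows "A \<subseteq> B \<longleftrightarrow> l B \<le> l A \<and> r A \<le> r B \<and> b B \<le> b A \<and> t A \<le> t B"
proof
  assume "A \<subseteq> B"
  moreover have "pt (l A) (b A) \<in> A" "pt (r A) (t A) \<in> A" using pt_in[OF assms(1)] lr bt assms by simp_all
  ultimately have "pt (l A) (b A) \<in> B" "pt (r A) (t A) \<in> B" by blast+
  then show "l B \<le> l A \<and> r A \<le> r B \<and> b B \<le> b A \<and> t A \<le> t B" using pt_in[OF assms(2)] by simp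
next
  assume *: "l B \<le> l A \<and> r A \<le> r B \<and> b B \<le> b A \<and> t A \<le> t B"
  show "A \<subseteq> B"
  proof
    fix p assume "p \<in> A"
    then show "p \<in> B" using * in_rect[OF assms(1), of p] in_rect[OF assms(2), of p] by linarith
  qed
qed

lemma rect_meet:
  assumes "A \<in> F" "B \<in> F"
  shows "A \<inter> B \<noteq> {} \<longleftrightarrow> l A \<le> r B \<and> l B \<le> r A \<and> b A \<le> t B \<and> b B \<le> t A"
proof
  assume "A \<inter> B \<noteq> {}"
  then obtain p where "p \<in> A" "p \<in> B" by blast
  then show "l A \<le> r B \<and> l B \<le> r A \<and> b A \<le> t B \<and> b B \<le> t A"
    using in_rect[OF assms(1), of p] in_rect[OF assms(2), of p] by linarith
next
  assume "l A \<le> r B \<and> l B \<le> r A \<and> b A \<le> t B \<and> b B \<le> t A"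
  then have "pt (max (l A) (l B)) (max (b A) (b B)) \<in> A \<inter> B"
    using assms lr bt by (simp add: pt_in)
  then show "A \<inter> B \<noteq> {}" by blast
qed

lemma rect_overlap:
  assumes "A \<in> F" "B \<in> F"
  shows "overlap A B \<longleftrightarrow> l A \<le> r B \<and> l B \<le> r A \<and> b A \<le> t B \<and> b B \<le> t A \<and>
    \<not> (l B \<le> l A \<and> r A \<le> r B \<and> b B \<le> b A \<and> t A \<le> t B) \<and>
    \<not> (l A \<le> l B \<and> r B \<le> r A \<and> b A \<le> b B \<and> t B \<le> t A)"
  unfolding overlap_def by (simp add: rect_meet rect_subset assms)

lemma rect_family_swap: "rect_family F w py px (\<lambda>x y. pt y x) b t l r"
proof
  fix A assume "A \<in> F"
  then show "A = {p. b A \<le> py p \<and> py p \<le> t A \<and> l A \<le> px p \<and> px p \<le> r A}"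
    using rect[of A] by (simp add: conj_ac)
qed (use finF cleanF cliqF px_pt py_pt lr bt in auto)

lemma colb_thin: "colb F (\<lambda>A B. overlap A B \<and> (thin A B \<or> thin B A)) w"
proof (rule colb_mirsky[OF finF, where R="\<lambda>A B. overlap A B \<and> thin A B"])
  fix A B C assume "A \<in> F" "B \<in> F" "C \<in> F" "overlap A B \<and> thin A B" "overlap B C \<and> thin B C"
  then show "overlap A C \<and> thin A C"
    using lr[of A] bt[of C] unfolding thin_def by (simp add: rect_overlap) linarith
next
  fix K assume "K \<subseteq> F" "\<And>x y. x \<in> K \<Longrightarrow> y \<in> K \<Longrightarrow> x \<noteq> y \<Longrightarrow> overlap x y \<and> thin x y \<or> overlap y x \<and> thin y x"
  then show "card K \<le> w" by (intro cliques_leD[OF cliqF]) (use overlap_sym in blast)+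
qed (auto simp: overlap_irrefl overlap_commute)

text \<open>Rectangles through a common vertical line that overlap either do so like their vertical
  sides, or are comparable in one of two partial orders.\<close>

lemma colb_vertical_line:
  assumes noncross: "\<And>A B. A \<in> F \<Longrightarrow> B \<in> F \<Longrightarrow> overlap A B \<Longrightarrow> \<not> thin A B"
  shows "colb {X\<in>F. l X \<le> x0 \<and> x0 \<le> r X} overlap (line_const w)"
proof -
  define D where "D = {X\<in>F. l X \<le> x0 \<and> x0 \<le> r X}"
  have DF: "X \<in> F" "l X \<le> x0" "x0 \<le> r X" if "X \<in> D" for X using that unfolding D_def by auto
  have finD: "finite D" unfolding D_def using finF by simp
  \<comment> \<open>Nested vertically and shifted to the right, or to the left in \<open>R2\<close>.
    On a common vertical line either relation forces an overlap, so chains are cliques.\<close>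
  define R1 where "R1 X Y \<longleftrightarrow> b Y \<le> b X \<and> t X \<le> t Y \<and> l Y < l X \<and> r Y < r X" for X Y
  define R2 where "R2 X Y \<longleftrightarrow> b Y \<le> b X \<and> t X \<le> t Y \<and> l X < l Y \<and> r X < r Y" for X Y
  have ovR: "overlap X Y" if "X \<in> D" "Y \<in> D" "R1 X Y \<or> R2 X Y" for X Y
    using that(3) rect_overlap[OF DF(1)[OF that(1)] DF(1)[OF that(2)]] DF[OF that(1)] DF[OF that(2)]
      bt[OF DF(1)[OF that(1)]] unfolding R1_def R2_def by linarith
  have cR1: "colb D (\<lambda>X Y. R1 X Y \<or> R1 Y X) w"
  proof (rule colb_mirsky[OF finD, where R=R1])
    fix K assume K: "K \<subseteq> D" "\<And>x y. x \<in> K \<Longrightarrow> y \<in> K \<Longrightarrow> x \<noteq> y \<Longrightarrow> R1 x y \<or> R1 y x"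
    show "card K \<le> w"
    proof (rule cliques_leD[OF cliqF])
      show "K \<subseteq> F" using K(1) unfolding D_def by blast
      show "overlap x y" if "x \<in> K" "y \<in> K" "x \<noteq> y" for x y
        using K(2)[OF that] ovR[of x y] ovR[of y x] overlap_sym[of y x] K(1) that by auto
    qed
  qed (auto simp: R1_def)
  have cR2: "colb D (\<lambda>X Y. R2 X Y \<or> R2 Y X) w"
  proof (rule colb_mirsky[OF finD, where R=R2])
    fix K assume K: "K \<subseteq> D" "\<And>x y. x \<in> K \<Longrightarrow> y \<in> K \<Longrightarrow> x \<noteq> y \<Longrightarrow> R2 x y \<or> R2 y x"
    show "card K \<le> w"
    proof (rule cliques_leD[OF cliqF])
      show "K \<subseteq> F" using K(1) unfolding D_def by blast
      show "overlap x y" if "x \<in> K" "y \<in> K" "x \<noteq> y" for x y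
        using K(2)[OF that] ovR[of x y] ovR[of y x] overlap_sym[of y x] K(1) that by auto
    qed
  qed (auto simp: R2_def)
  have "colb D overlap (w * (w * interval_const w))"
  proof (rule colb_refine[OF cR1], rule colb_refine)
    fix D1 assume "D1 \<subseteq> D"
    then show "colb D1 (\<lambda>X Y. R2 X Y \<or> R2 Y X) w" by (rule colb_mono[OF cR2]) auto
  next
    fix D1 D2 assume D1: "D1 \<subseteq> D" "\<And>x y. x \<in> D1 \<Longrightarrow> y \<in> D1 \<Longrightarrow> \<not> (R1 x y \<or> R1 y x)"
      and D2: "D2 \<subseteq> D1" "\<And>x y. x \<in> D2 \<Longrightarrow> y \<in> D2 \<Longrightarrow> \<not> (R2 x y \<or> R2 y x)"
    have D2D: "X \<in> D" if "X \<in> D2" for X using that D1(1) D2(1) by blast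
    have D2F: "X \<in> F" if "X \<in> D2" for X using DF(1)[OF D2D[OF that]] .
    \<comment> \<open>Without \<open>R1\<close> and \<open>R2\<close> the horizontal projections
      would be nested too, giving \<open>X \<subseteq> Y\<close> or the crossing
      \<open>thin Y X\<close>.\<close>
    have nest: "\<not> overlap X Y" if X: "X \<in> D2" and Y: "Y \<in> D2" and "b Y \<le> b X" "t X \<le> t Y" for X Y
    proof
      assume o: "overlap X Y"
      have nR: "\<not> R1 X Y" "\<not> R2 X Y" using D1(2)[of X Y] D2 X Y by auto
      have "\<not> thin Y X" using noncross[OF D2F[OF Y] D2F[OF X] overlap_sym[OF o]] .
      then show False
        using nR that(3,4) rect_overlap[OF D2F[OF X] D2F[OF Y]] o unfolding R1_def R2_def thin_def by linarith
    qed
    define I where "I X = {b X..t X}" for X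
    have I: "Inf (I X) = b X" "Sup (I X) = t X" if "X \<in> D2" for X
      using bt[OF D2F[OF that]] unfolding I_def by simp_all
    have Isub: "I X \<subseteq> I Y \<longleftrightarrow> b Y \<le> b X \<and> t X \<le> t Y" if "X \<in> D2" for X Y
      using bt[OF D2F[OF that]] unfolding I_def by simp
    have ovI: "overlap X Y" if X: "X \<in> D2" and Y: "Y \<in> D2" and o: "overlap (I X) (I Y)" for X Y
    proof -
      have "b X \<le> t Y" "b Y \<le> t X" using o unfolding overlap_def I_def by auto
      moreover have "\<not> (b Y \<le> b X \<and> t X \<le> t Y)" "\<not> (b X \<le> b Y \<and> t Y \<le> t X)"
        using o Isub X Y unfolding overlap_def by simp_all
      ultimately show ?thesis
        using rect_overlap[OF D2F[OF X] D2F[OF Y]] DF[OF D2D[OF X]] DF[OF D2D[OF Y]] by linarith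
    qed
    have "colb (I ` D2) overlap (interval_const w)"
    proof (rule colb_intervals)
      have "finite D2" using finD D1(1) D2(1) by (meson finite_subset)
      then show "finite (I ` D2)" by simp
      show "A = {Inf A..Sup A} \<and> Inf A \<le> Sup A" if "A \<in> I ` D2" for A
        using that I bt D2F unfolding I_def by auto
      show "clean_family (I ` D2)" unfolding clean_family_def
      proof (intro notI, elim bexE imageE conjE)
        fix A B S X Y Z assume *: "X \<in> D2" "A = I X" "Y \<in> D2" "B = I Y" "Z \<in> D2" "S = I Z"
          "overlap A B" "S \<subseteq> A" "S \<subseteq> B"
        have o: "overlap (I X) (I Y)" using * by simp
        \<comment> \<open>\<open>Z\<close> and \<open>U\<close> meet on the line and do not overlap
          by \<open>nest\<close>; \<open>U \<subseteq> Z\<close> would put \<open>I U\<close> inside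
          \<open>I U'\<close>.\<close>
        have sub: "Z \<subseteq> U" if "U \<in> D2" "U' \<in> D2" "I Z \<subseteq> I U" "I Z \<subseteq> I U'" "overlap (I U) (I U')" for U U'
        proof -
          have "\<not> overlap Z U" using nest[OF *(5) that(1)] that(3) Isub[OF *(5)] by simp
          moreover have "Z \<inter> U \<noteq> {}"
            using rect_meet[OF D2F[OF *(5)] D2F[OF that(1)]] that(3) Isub[OF *(5)] bt[OF D2F[OF *(5)]]
              DF[OF D2D[OF *(5)]] DF[OF D2D[OF that(1)]] by auto
          moreover have "\<not> U \<subseteq> Z"
          proof
            assume "U \<subseteq> Z"
            then have "I U \<subseteq> I Z" using Isub[OF that(1)] rect_subset[OF D2F[OF that(1)] D2F[OF *(5)]] by simp
            then show False using that(4,5) unfolding overlap_def by blast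
          qed
          ultimately show ?thesis unfolding overlap_def by blast
        qed
        have "Z \<subseteq> X" "Z \<subseteq> Y" using sub[OF *(1,3)] sub[OF *(3,1)] * o overlap_sym[OF o] by simp_all
        then show False
          using clean_familyD[OF cleanF D2F[OF *(1)] D2F[OF *(3)] D2F[OF *(5)] ovI[OF *(1,3) o]] by simp
      qed
      show "cliques_le (I ` D2) w" unfolding cliques_le_def
      proof (intro allI impI)
        fix K assume K: "K \<subseteq> I ` D2" "\<forall>A\<in>K. \<forall>B\<in>K. A \<noteq> B \<longrightarrow> overlap A B"
        obtain K' where K': "K' \<subseteq> D2" "inj_on I K'" "K = I ` K'" using subset_image_inj[of K I D2] K(1) by blast
        have "card K = card K'" using K' by (simp add: card_image)
        also have "\<dots> \<le> w"
        proof (rule cliques_leD[OF cliqF])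
          show "K' \<subseteq> F" using K'(1) D2F by blast
          fix X Y assume XY: "X \<in> K'" "Y \<in> K'" "X \<noteq> Y"
          then have "I X \<noteq> I Y" using K'(2) by (meson inj_onD)
          then have "overlap (I X) (I Y)" using K(2) XY unfolding K'(3) by simp
          then show "overlap X Y" using ovI XY K'(1) by auto
        qed
        finally show "card K \<le> w" .
      qed
    qed
    then have "colb D2 (\<lambda>X Y. overlap (I X) (I Y)) (interval_const w)" by (rule colb_image)
    then show "colb D2 overlap (interval_const w)"
    proof (rule colb_mono)
      fix X Y assume X: "X \<in> D2" and Y: "Y \<in> D2" and o: "overlap X Y"
      have "b X \<le> t Y" "b Y \<le> t X" using o rect_overlap[OF D2F[OF X] D2F[OF Y]] by simp_all
      then have "I X \<inter> I Y \<noteq> {}" using bt[OF D2F[OF X]] bt[OF D2F[OF Y]] unfolding I_def by auto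
      moreover have "\<not> I X \<subseteq> I Y" "\<not> I Y \<subseteq> I X"
        using nest[OF X Y] nest[OF Y X] o overlap_sym[OF o] Isub[OF X] Isub[OF Y] by auto
      ultimately show "overlap (I X) (I Y)" unfolding overlap_def by blast
    qed auto
  qed
  then show ?thesis unfolding D_def line_const_def .
qed

end

section \<open>Crossing-free families of rectangles\<close>

lemma colb_all_blocks:
  assumes "\<And>y. colb {X\<in>D. P X y} E q" "\<And>X. X \<in> D \<Longrightarrow> P X (h X)"
  shows "colb D (\<lambda>X Y. E X Y \<and> h X = h Y) q"
proof (rule colb_blocks[where h=h])
  fix y
  show "colb {X\<in>D. h X = y} (\<lambda>X Y. E X Y \<and> h X = h Y) q"
    by (rule colb_mono[OF assms(1)[of y]]) (use assms(2) in auto)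
qed simp

section \<open>Ranks in a finite set and the powers of two dividing them\<close>

definition rank :: "real set \<Rightarrow> real \<Rightarrow> nat" where
  "rank T y = card {s\<in>T. s \<le> y}"

lemma rank_strict:
  assumes "finite T" "x \<in> T" "y \<in> T"
  shows "rank T x < rank T y \<longleftrightarrow> x < y"
proof -
  have less: "rank T x < rank T y" if "x < y" "y \<in> T" for x y
    unfolding rank_def by (rule psubset_card_mono) (use that assms(1) in force)+
  show ?thesis using less[of x y] less[of y x] assms by (cases x y rule: linorder_cases) auto
qed

lemma rank_bounds:
  assumes "finite T" "y \<in> T"
  shows "0 < rank T y" "rank T y \<le> card T"
  using assms unfolding rank_def by (auto simp: card_gt_0_iff intro: card_mono)

lemma rank_surj:
  assumes "finite T" "1 \<le> k" "k \<le> card T"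
  shows "\<exists>y\<in>T. rank T y = k"
proof -
  have inj: "inj_on (rank T) T"
  proof (rule inj_onI)
    fix x y assume "x \<in> T" "y \<in> T" "rank T x = rank T y"
    then show "x = y" using rank_strict[OF assms(1), of x y] rank_strict[OF assms(1), of y x] by simp
  qed
  have "rank T ` T \<subseteq> {1..card T}" using rank_bounds[OF assms(1)] by (force simp: Suc_le_eq)
  then have "rank T ` T = {1..card T}" using card_image[OF inj] by (intro card_subset_eq) auto
  then show ?thesis using assms by (metis atLeastAtMost_iff imageE)
qed

text \<open>The ranks are \<open>2 ^ v * i\<close> and \<open>2 ^ v * j\<close> with
  \<open>i < j\<close>, and one of \<open>i\<close>, \<open>i + 1\<close> is even. Every value up to
  \<open>card T\<close> is a rank, so some \<open>z\<close> attains it. This replaces the recursive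
  bisection.\<close>

lemma finer_rank:
  assumes T: "finite T" and xy: "x \<in> T" "y \<in> T" "x < y" and "2 ^ v dvd rank T x" "2 ^ v dvd rank T y"
  shows "\<exists>z\<in>T. x \<le> z \<and> z \<le> y \<and> 2 ^ Suc v dvd rank T z"
proof -
  obtain i j where ij: "rank T x = 2 ^ v * i" "rank T y = 2 ^ v * j" using assms(5,6) unfolding dvd_def by blast
  have "rank T x < rank T y" using rank_strict[OF T xy(1,2)] xy(3) by simp
  then have "i < j" using ij by simp
  define k where "k = (if even i then i else Suc i)"
  have k: "even k" "i \<le> k" "k \<le> j" using \<open>i < j\<close> unfolding k_def by auto
  have le: "rank T x \<le> 2 ^ v * k" "2 ^ v * k \<le> rank T y" using k ij by simp_all
  then have "1 \<le> 2 ^ v * k" "2 ^ v * k \<le> card T"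
    using rank_bounds[OF T xy(1)] rank_bounds[OF T xy(2)] by linarith+
  then obtain z where z: "z \<in> T" "rank T z = 2 ^ v * k" using rank_surj[OF T] by blast
  have "x \<le> z" "z \<le> y"
    using le z rank_strict[OF T z(1) xy(1)] rank_strict[OF T xy(2) z(1)] by linarith+
  moreover have "2 ^ Suc v dvd rank T z" using k(1) unfolding z(2) by (auto elim!: evenE simp: mult_ac)
  ultimately show ?thesis using z(1) by blast
qed

section \<open>Corners and walls of non-crossing rectangles\<close>

locale rect_root = rect_family +
  fixes Om :: "'a set"
  assumes noncross: "A \<in> F \<Longrightarrow> B \<in> F \<Longrightarrow> overlap A B \<Longrightarrow> \<not> thin A B"
    and rootF: "Om \<in> F" and below_rootF: "A \<in> F \<Longrightarrow> A \<subseteq> Om"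
begin

definition corner_pt :: "bool \<times> bool \<Rightarrow> 'a set \<Rightarrow> 'a" where
  "corner_pt c A = pt (if fst c then l A else r A) (if snd c then b A else t A)"

lemma corner_pt_in:
  assumes "B \<in> F"
  shows "corner_pt c A \<in> B \<longleftrightarrow>
    (if fst c then l B \<le> l A \<and> l A \<le> r B else l B \<le> r A \<and> r A \<le> r B) \<and>
    (if snd c then b B \<le> b A \<and> b A \<le> t B else b B \<le> t A \<and> t A \<le> t B)"
  unfolding corner_pt_def using pt_in[OF assms] by simp

text \<open>If in both directions an end of the projection of \<open>B\<close> lay in that of
  \<open>A\<close>, they would form a corner of \<open>B\<close> in \<open>A\<close>. In a direction
  where neither end does, the meeting projections are strictly nested.\<close>

lemma no_corner:
  assumes "A \<in> F" "B \<in> F" "overlap A B" "\<not> (\<exists>c. corner_pt c B \<in> A)"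
  shows "l B < l A \<and> r A < r B \<or> b B < b A \<and> t A < t B"
proof -
  have "corner_pt (True, True) B \<notin> A" "corner_pt (True, False) B \<notin> A"
    "corner_pt (False, True) B \<notin> A" "corner_pt (False, False) B \<notin> A"
    using assms(4) by blast+
  then show ?thesis
    using assms(3) lr[OF assms(1)] lr[OF assms(2)] bt[OF assms(1)] bt[OF assms(2)]
    unfolding rect_overlap[OF assms(1,2)] corner_pt_in[OF assms(1)] fst_conv snd_conv if_True if_False
    by linarith
qed

sublocale corner_family F w "UNIV :: (bool \<times> bool) set" corner_pt Om
proof
  show "finite F" "clean_family F" "cliques_le F w" by (fact finF cleanF cliqF)+
  show "A \<noteq> {}" if "A \<in> F" for A using pt_in[OF that, of "l A" "b A"] lr[OF that] bt[OF that] by auto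
  fix Z S V and c :: "bool \<times> bool"
  assume *: "Z \<in> F" "S \<in> F" "V \<in> F" "S \<subseteq> Z" "corner_pt c Z \<in> V" "V \<inter> S \<noteq> {}"
  have "l S \<le> r S" "b S \<le> t S" using lr bt * by simp_all
  then show "corner_pt c S \<in> V"
    using *(4-6) unfolding corner_pt_in[OF *(3)] rect_subset[OF *(2,1)] rect_meet[OF *(3,2)]
    by (auto split: if_splits)
next
  fix A B assume *: "A \<in> F" "B \<in> F" "overlap A B"
  have "\<not> thin A B" "\<not> thin B A" using noncross * overlap_sym by blast+
  \<comment> \<open>Without any corner, each would be strictly inside the other in one direction;
    these directions differ, so this is a crossing.\<close>
  then have "(\<exists>c. corner_pt c A \<in> B) \<or> (\<exists>c. corner_pt c B \<in> A)"
    using no_corner[OF *] no_corner[OF *(2,1) overlap_sym[OF *(3)]]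
    unfolding thin_def by (metis less_asym less_imp_le)
  then show "\<exists>c\<in>UNIV. corner_pt c A \<in> B \<or> corner_pt c B \<in> A" by blast
qed (use rootF below_rootF in auto)

lemma rect_root_swap: "rect_root F w py px (\<lambda>x y. pt y x) b t l r Om"
proof -
  interpret sw: rect_family F w py px "\<lambda>x y. pt y x" b t l r by (rule rect_family_swap)
  show ?thesis
  proof
    fix A B assume "A \<in> F" "B \<in> F" "overlap A B"
    \<comment> \<open>Exchanging the axes turns \<open>thin A B\<close> into
      \<open>thin B A\<close>.\<close>
    then show "\<not> sw.thin A B" using noncross[of B A] overlap_sym[of A B] unfolding sw.thin_def thin_def by auto
  qed (use rootF below_rootF in auto)
qed

lemma colb_vertical: "colb {X\<in>F. l X \<le> x0 \<and> x0 \<le> r X} overlap (line_const w)"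
  using noncross by (rule colb_vertical_line)

lemma colb_horizontal: "colb {X\<in>F. b X \<le> y0 \<and> y0 \<le> t X} overlap (line_const w)"
proof -
  interpret sw: rect_root F w py px "\<lambda>x y. pt y x" b t l r Om by (rule rect_root_swap)
  show ?thesis by (rule sw.colb_vertical)
qed

definition wall_const :: nat where
  "wall_const = card (UNIV :: (bool \<times> bool) set) * w * (2 * line_const w)"

text \<open>A part of \<open>A\<close> that meets \<open>V\<close> but is not inside it leaves
  \<open>V\<close> across one of the two sides away from the corner of \<open>A\<close>. So each
  member meets the vertical line at \<open>x0\<close> or the horizontal line at
  \<open>y0\<close>.\<close>

lemma colb_corner_walls:
  assumes D: "\<And>X. X \<in> D \<Longrightarrow> X \<in> F \<and> Z X \<in> F \<and> X \<subseteq> Z X \<and>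
      (\<exists>V\<in>F. \<exists>c. overlap (Z X) V \<and> corner_pt c (Z X) \<in> V \<and> V \<inter> X \<noteq> {})"
  shows "colb D (\<lambda>X Y. overlap X Y \<and> Z X = Z Y) wall_const"
  unfolding wall_const_def
proof (rule colb_walls)
  fix X assume "X \<in> D"
  then show "X \<in> F \<and> Z X \<in> F \<and> X \<subseteq> Z X \<and>
      (\<exists>V\<in>F. \<exists>c\<in>UNIV. overlap (Z X) V \<and> corner_pt c (Z X) \<in> V \<and> V \<inter> X \<noteq> {})" using D by simp
next
  fix D' V c A
  assume D': "D' \<subseteq> D" and V: "V \<in> F" "A \<in> F" "corner_pt c A \<in> V"
    and X: "\<And>X. X \<in> D' \<Longrightarrow> X \<subseteq> A \<and> V \<inter> X \<noteq> {} \<and> \<not> X \<subseteq> V"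
  have D'F: "X \<in> F" if "X \<in> D'" for X using D' D that by blast
  define x0 y0 where "x0 = (if fst c then r V else l V)" and "y0 = (if snd c then t V else b V)"
  have cross: "l X \<le> x0 \<and> x0 \<le> r X \<or> b X \<le> y0 \<and> y0 \<le> t X" if XD: "X \<in> D'" for X
  proof -
    note XF = D'F[OF XD]
    have "l X \<le> r X" "b X \<le> t X" using lr bt XF by simp_all
    then show ?thesis
      using X[OF XD] V(3) unfolding corner_pt_in[OF V(1)] rect_meet[OF V(1) XF] rect_subset[OF XF V(1)]
        rect_subset[OF XF V(2)] x0_def y0_def by (auto split: if_splits)
  qed
  show "colb D' overlap (2 * line_const w)"
  proof (rule colb_split[where g="\<lambda>X. if l X \<le> x0 \<and> x0 \<le> r X then 0 else 1"])
    fix i :: nat assume "i < 2"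
    then consider "i = 0" | "i = 1" by linarith
    then show "colb {X\<in>D'. (if l X \<le> x0 \<and> x0 \<le> r X then 0 else 1) = i} overlap (line_const w)"
    proof cases
      case 1
      show ?thesis by (rule colb_mono[OF colb_vertical[of x0]]) (use 1 D'F in auto)
    next
      case 2
      show ?thesis by (rule colb_mono[OF colb_horizontal[of y0]]) (use 2 D'F cross in force)+
    qed
  qed simp
qed

end

section \<open>Horizontal levels\<close>

text \<open>\<open>j\<close> is the highest binary digit in which the numbers differ, found as the
  least position above which all digits agree.\<close>

lemma ex_top_bit:
  fixes m n :: nat
  assumes "m < n" "n < 2 ^ J"
  shows "\<exists>j<J. m div 2 ^ Suc j = n div 2 ^ Suc j \<and> m div 2 ^ j < n div 2 ^ j"
proof -
  define P where "P i \<longleftrightarrow> m div 2 ^ Suc i = n div 2 ^ Suc i" for i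
  have J: "0 < J" using assms by (cases J) auto
  then have PJ: "P (J - 1)" using assms unfolding P_def by simp
  define j where "j = (LEAST i. P i)"
  have "P j" unfolding j_def using PJ by (rule LeastI)
  moreover have "j < J" using Least_le[of P, OF PJ] J unfolding j_def by linarith
  moreover have "m div 2 ^ j < n div 2 ^ j"
  proof (cases j)
    case 0
    then show ?thesis using assms by simp
  next
    case (Suc i)
    then have "\<not> P i" unfolding j_def using not_less_Least by (metis lessI)
    then have "m div 2 ^ j \<noteq> n div 2 ^ j" unfolding P_def Suc .
    moreover have "m div 2 ^ j \<le> n div 2 ^ j" using assms(1) by (intro div_le_mono) simp
    ultimately show ?thesis by simp
  qed
  ultimately show ?thesis unfolding P_def by blast
qed

context rect_root
begin

definition bits_const :: nat where
  "bits_const = (2 * (card (UNIV :: (bool \<times> bool) set) * w) + 1) * wall_const"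

lemma w_pos: "0 < w"
  using cliques_leD[OF cliqF, of "{Om}"] rootF by simp

lemma consts_pos: "0 < line_const w" "0 < wall_const" "0 < bits_const"
proof -
  have "0 < card (UNIV :: (bool \<times> bool) set)" by (simp add: card_gt_0_iff)
  then show "0 < line_const w" "0 < wall_const" "0 < bits_const"
    using w_pos unfolding line_const_def interval_const_def wall_const_def bits_const_def by simp_all
qed

text \<open>The wall \<open>hat Q (lca X Q)\<close> of \<open>X\<close> contains a corner of the maximal member of \<open>D\<close> above \<open>X\<close>: it
  leaves that member vertically because of the levels and horizontally because of the hats.\<close>

lemma colb_high_walls:
  fixes lev :: "'a set \<Rightarrow> nat"
  assumes D: "D \<subseteq> F" and low: "\<And>X. X \<in> D \<Longrightarrow> lev X < \<theta>"
    and lev_mono: "\<And>X Y. X \<in> F \<Longrightarrow> Y \<in> F \<Longrightarrow> b Y \<le> b X \<Longrightarrow> t X \<le> t Y \<Longrightarrow> lev X \<le> lev Y"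
    and wall: "\<And>X. X \<in> D \<Longrightarrow> \<exists>Q\<in>F. overlap X Q \<and> \<theta> \<le> lev (hat Q (lca X Q)) \<and>
        \<not> (l (hat Q (lca X Q)) \<le> l (hat X (lca X Q)) \<and> r (hat X (lca X Q)) \<le> r (hat Q (lca X Q))) \<and>
        \<not> (l (hat X (lca X Q)) \<le> l (hat Q (lca X Q)) \<and> r (hat Q (lca X Q)) \<le> r (hat X (lca X Q)))"
  shows "colb D overlap bits_const"
proof -
  define M where "M X = \<Union>{Y\<in>D. X \<subseteq> Y}" for X
  have MD: "M X \<in> {Y\<in>D. X \<subseteq> Y}" if "X \<in> D" for X unfolding M_def
  proof (rule chain_greatest)
    show "finite {Y\<in>D. X \<subseteq> Y}" using D finF by (auto intro: finite_subset)
    show "{Y\<in>D. X \<subseteq> Y} \<noteq> {}" using that by blast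
    show "A \<subseteq> B \<or> B \<subseteq> A" if "A \<in> {Y\<in>D. X \<subseteq> Y}" "B \<in> {Y\<in>D. X \<subseteq> Y}" for A B
      using containers_chain[of X A B] that \<open>X \<in> D\<close> D by auto
  qed
  have M: "M X \<in> D" "X \<subseteq> M X" if "X \<in> D" for X using MD[OF that] by simp_all
  have M_ge: "Y \<subseteq> M X" if "Y \<in> D" "X \<subseteq> Y" for X Y using that unfolding M_def by blast
  have anti: "\<not> M X \<subset> M Y" if "X \<in> D" "Y \<in> D" for X Y
    using M_ge[OF M(1)[OF that(2)], of X] M(2)[OF that(1)] by blast
  have "colb (M ` D) overlap (2 * (card (UNIV :: (bool \<times> bool) set) * w) + 1)"
  proof (rule colb_antichain)
    show "M ` D \<subseteq> F" using M(1) D by blast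
    show "\<not> A \<subset> B" if "A \<in> M ` D" "B \<in> M ` D" for A B using that anti by (elim imageE) simp
  qed
  then have c1: "colb D (\<lambda>X Y. overlap (M X) (M Y)) (2 * (card (UNIV :: (bool \<times> bool) set) * w) + 1)"
    by (rule colb_image)
  show ?thesis unfolding bits_const_def
  proof (rule colb_refine[OF c1])
    fix D' assume D': "D' \<subseteq> D" "\<And>X Y. X \<in> D' \<Longrightarrow> Y \<in> D' \<Longrightarrow> \<not> overlap (M X) (M Y)"
    have D'D: "X \<in> D" if "X \<in> D'" for X using that D'(1) by blast
    have "colb D' (\<lambda>X Y. overlap X Y \<and> M X = M Y) wall_const"
    proof (rule colb_corner_walls)
      fix X assume "X \<in> D'"
      then have XD: "X \<in> D" by (rule D'D)
      have XF: "X \<in> F" and MF: "M X \<in> F" using XD M(1)[OF XD] D by blast+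
      obtain Q where Q: "Q \<in> F" "overlap X Q" "\<theta> \<le> lev (hat Q (lca X Q))"
        "\<not> (l (hat Q (lca X Q)) \<le> l (hat X (lca X Q)) \<and> r (hat X (lca X Q)) \<le> r (hat Q (lca X Q)))"
        "\<not> (l (hat X (lca X Q)) \<le> l (hat Q (lca X Q)) \<and> r (hat Q (lca X Q)) \<le> r (hat X (lca X Q)))"
        using wall[OF XD] by blast
      define H V where "H = hat X (lca X Q)" and "V = hat Q (lca X Q)"
      note h = hats[OF XF Q(1,2), folded H_def V_def]
      have levM: "lev (M X) < lev V" using low[OF M(1)[OF XD]] Q(3) unfolding V_def by simp
      have lev_sub: "lev A \<le> lev B" if "A \<in> F" "B \<in> F" "A \<subseteq> B" for A B
        using lev_mono[OF that(1,2)] that(3) rect_subset[OF that(1,2)] by simp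
      \<comment> \<open>Otherwise \<open>M X\<close> would contain \<open>V\<close>, whose level is
        at least \<theta>.\<close>
      have "M X \<subset> lca X Q"
      proof (rule ccontr)
        assume "\<not> M X \<subset> lca X Q"
        then have "lca X Q \<subseteq> M X"
          using containers_chain[OF XF MF lca_in[OF XF Q(1)] M(2)[OF XD] lca_sup(1)] by blast
        then have "V \<subseteq> M X" using h(6) by blast
        then show False using lev_sub[OF h(2) MF] levM by simp
      qed
      then have MH: "M X \<subseteq> H" unfolding H_def by (intro hat_sub MF M(2)[OF XD])
      have o: "overlap (M X) V"
        using overlap_up(1)[OF XF Q(1,2) MF M(2)[OF XD] \<open>M X \<subset> lca X Q\<close> h(2,4,6)] .
      have nest: "\<not> (b (M X) \<le> b V \<and> t V \<le> t (M X))"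
        using lev_mono[OF h(2) MF] levM by auto
      have "\<exists>c. corner_pt c (M X) \<in> V"
      proof -
        have "l H \<le> l (M X)" "r (M X) \<le> r H" using MH rect_subset[OF MF h(1)] by simp_all
        moreover have "\<not> (l V \<le> l H \<and> r H \<le> r V)" "\<not> (l H \<le> l V \<and> r V \<le> r H)"
          using Q(4,5) unfolding H_def V_def .
        moreover have "l V \<le> r (M X)" "l (M X) \<le> r V" "b V \<le> t (M X)" "b (M X) \<le> t V"
          using o rect_overlap[OF MF h(2)] by simp_all
        \<comment> \<open>Horizontally \<open>V\<close> leaves \<open>H \<supseteq> M X\<close> on
          exactly one side, so it covers an end of \<open>M X\<close>. Vertically it is enough that
          \<open>V\<close> meets \<open>M X\<close> and is not nested in it.\<close>
        ultimately have "l V \<le> l (M X) \<and> l (M X) \<le> r V \<or> l V \<le> r (M X) \<and> r (M X) \<le> r V"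
          "b V \<le> b (M X) \<and> b (M X) \<le> t V \<or> b V \<le> t (M X) \<and> t (M X) \<le> t V"
          using nest by linarith+
        then have "corner_pt (l V \<le> l (M X) \<and> l (M X) \<le> r V, b V \<le> b (M X) \<and> b (M X) \<le> t V) (M X) \<in> V"
          unfolding corner_pt_in[OF h(2)] by auto
        then show ?thesis by blast
      qed
      moreover have "V \<inter> X \<noteq> {}" using h(8) unfolding overlap_def by blast
      ultimately show "X \<in> F \<and> M X \<in> F \<and> X \<subseteq> M X \<and>
          (\<exists>V\<in>F. \<exists>c. overlap (M X) V \<and> corner_pt c (M X) \<in> V \<and> V \<inter> X \<noteq> {})"
        using XF MF M(2)[OF XD] o h(2) by blast
    qed
    then show "colb D' overlap wall_const"
    proof (rule colb_mono)
      fix X Y assume XY: "X \<in> D'" "Y \<in> D'" "overlap X Y"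
      have "M X \<inter> M Y \<noteq> {}" using XY(3) M(2)[OF D'D[OF XY(1)]] M(2)[OF D'D[OF XY(2)]]
        unfolding overlap_def by blast
      then have "M X \<subseteq> M Y \<or> M Y \<subseteq> M X" using D'(2)[OF XY(1,2)] unfolding overlap_def by blast
      then have "M X = M Y"
        using anti[OF D'D[OF XY(1)] D'D[OF XY(2)]] anti[OF D'D[OF XY(2)] D'D[OF XY(1)]] by blast
      then show "overlap X Y \<and> M X = M Y" using XY(3) by simp
    qed auto
  qed
qed

text \<open>The level of a rectangle is the largest \<open>v\<close> such that it meets a horizontal line whose rank is
  divisible by \<open>2 ^ v\<close>. A rectangle whose highest wall has level \<open>\<mu>\<close> above its own level \<open>v\<close> is
  coloured by the top bit in which \<open>\<mu>\<close> and \<open>v\<close> differ.\<close>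

lemma colb_bits:
  assumes D: "D \<subseteq> F"
    and nonnest: "\<And>S Q. S \<in> D \<Longrightarrow> Q \<in> D \<Longrightarrow> overlap S Q \<Longrightarrow>
        \<not> (l (hat Q (lca S Q)) \<le> l (hat S (lca S Q)) \<and> r (hat S (lca S Q)) \<le> r (hat Q (lca S Q)))"
    and K: "2 * card F < 2 ^ K" "K < 2 ^ J"
  shows "colb D overlap (line_const w * (Suc J * bits_const))"
proof -
  define T where "T = b ` F \<union> t ` F"
  have finT: "finite T" unfolding T_def using finF by simp
  have "card T \<le> card (b ` F) + card (t ` F)" unfolding T_def by (rule card_Un_le)
  also have "\<dots> \<le> 2 * card F" using card_image_le[OF finF, of b] card_image_le[OF finF, of t] by simp
  finally have cardT: "card T < 2 ^ K" using K(1) by simp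
  define N where "N X = {v. \<exists>y\<in>T. b X \<le> y \<and> y \<le> t X \<and> 2 ^ v dvd rank T y}" for X
  define lev where "lev X = Max (N X)" for X
  have N_less: "v < K" if "v \<in> N X" for v X
  proof -
    obtain y where "y \<in> T" "2 ^ v dvd rank T y" using \<open>v \<in> N X\<close> unfolding N_def by blast
    then have "2 ^ v \<le> rank T y" "rank T y \<le> card T"
      using rank_bounds[OF finT, of y] by (auto intro: dvd_imp_le)
    then have "(2::nat) ^ v < 2 ^ K" using cardT by linarith
    then show ?thesis by simp
  qed
  have finN: "finite (N X)" for X by (rule finite_subset[of _ "{..<K}"]) (use N_less in auto)
  have N0: "0 \<in> N X" if "X \<in> F" for X using that bt[OF that] unfolding N_def T_def by auto
  have lev_in: "lev X \<in> N X" if "X \<in> F" for X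
    unfolding lev_def using finN N0[OF that] by (intro Max_in) auto
  have lev_ge: "v \<le> lev X" if "v \<in> N X" for v X unfolding lev_def using finN that by (intro Max_ge)
  have lev_mono: "lev X \<le> lev Y" if XY: "X \<in> F" "Y \<in> F" "b Y \<le> b X" "t X \<le> t Y" for X Y
  proof (rule lev_ge)
    obtain y where "y \<in> T" "b X \<le> y" "y \<le> t X" "2 ^ lev X dvd rank T y"
      using lev_in[OF XY(1)] unfolding N_def by blast
    then show "lev X \<in> N Y" using XY(3,4) unfolding N_def by (auto intro!: bexI[of _ y])
  qed
  have "\<forall>X. \<exists>y. X \<in> F \<longrightarrow> y \<in> T \<and> b X \<le> y \<and> y \<le> t X \<and> 2 ^ lev X dvd rank T y"
    using lev_in unfolding N_def by blast
  from choice[OF this] obtain line where line: "\<forall>X. X \<in> F \<longrightarrow>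
    line X \<in> T \<and> b X \<le> line X \<and> line X \<le> t X \<and> 2 ^ lev X dvd rank T (line X)" by blast
  \<comment> \<open>Otherwise \<open>finer_rank\<close> gives a line of higher level in between. As
    the vertical ranges meet, \<open>X\<close> or \<open>Y\<close> meets it, against the maximality
    of \<open>lev\<close>.\<close>
  have same_line: "\<not> line X < line Y"
    if X: "X \<in> F" and Y: "Y \<in> F" and m: "b Y \<le> t X" "b X \<le> t Y" and eq: "lev X = lev Y" for X Y
  proof
    assume less: "line X < line Y"
    obtain z where z: "z \<in> T" "line X \<le> z" "z \<le> line Y" "2 ^ Suc (lev X) dvd rank T z"
      using finer_rank[OF finT _ _ less, of "lev X"] line[THEN spec, of X] line[THEN spec, of Y] X Y
      unfolding eq by blast
    have "b X \<le> z" "z \<le> t Y" using z line X Y by (meson order_trans)+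
    then have "Suc (lev X) \<in> N X \<or> Suc (lev Y) \<in> N Y"
      using z m eq unfolding N_def by (cases "z \<le> t X") auto
    then show False using lev_ge[of "Suc (lev X)" X] lev_ge[of "Suc (lev Y)" Y] by auto
  qed
  have "colb F (\<lambda>X Y. overlap X Y \<and> line X = line Y) (line_const w)"
    by (rule colb_all_blocks[where P="\<lambda>X y. b X \<le> y \<and> y \<le> t X", OF colb_horizontal]) (use line in blast)
  then have c1: "colb D (\<lambda>X Y. overlap X Y \<and> line X = line Y) (line_const w)"
    by (rule colb_mono) (use D in auto)
  show ?thesis
  proof (rule colb_refine[OF c1])
    fix D1 assume D1: "D1 \<subseteq> D" "\<And>X Y. X \<in> D1 \<Longrightarrow> Y \<in> D1 \<Longrightarrow> \<not> (overlap X Y \<and> line X = line Y)"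
    have D1F: "X \<in> F" if "X \<in> D1" for X using that D1(1) D by blast
    have finD1: "finite D1" using D1(1) D finF by (meson finite_subset)
    have neq: "lev X \<noteq> lev Y" if "X \<in> D1" "Y \<in> D1" "overlap X Y" for X Y
      using D1(2)[OF that(1,2)] that(3) rect_overlap[OF D1F[OF that(1)] D1F[OF that(2)]]
        same_line[OF D1F[OF that(1)] D1F[OF that(2)]] same_line[OF D1F[OF that(2)] D1F[OF that(1)]]
      by (metis linorder_neqE_linordered_idom)
    define wl where "wl X = (\<lambda>Q. lev (hat Q (lca X Q))) ` {Q\<in>D1. overlap X Q}" for X
    \<comment> \<open>The inserted 0 is the value for an \<open>X\<close> that overlaps nothing in
      \<open>D1\<close>.\<close>
    define mu where "mu X = Max (insert 0 (wl X))" for X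
    have finwl: "finite (wl X)" for X unfolding wl_def using finD1 by simp
    have mu_ge: "lev (hat Q (lca X Q)) \<le> mu X" if "Q \<in> D1" "overlap X Q" for X Q
      unfolding mu_def using finwl that by (intro Max_ge) (auto simp: wl_def)
    have hatF: "hat Q (lca X Q) \<in> F" if "X \<in> D1" "Q \<in> D1" "overlap X Q" for X Q
      using hats(2) D1F that by blast
    have mu_lev: "lev Q \<le> mu X" if "X \<in> D1" "Q \<in> D1" "overlap X Q" for X Q
    proof -
      have "Q \<subseteq> hat Q (lca X Q)" using hats(4) D1F that by blast
      then have "lev Q \<le> lev (hat Q (lca X Q))"
        using lev_mono[OF D1F[OF that(2)] hatF[OF that]] rect_subset[OF D1F[OF that(2)] hatF[OF that]] by simp
      then show ?thesis using mu_ge[OF that(2,3)] by simp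
    qed
    have mu_in: "mu X \<in> insert 0 (wl X)" for X unfolding mu_def using finwl by (intro Max_in) auto
    have mu_less: "mu X < 2 ^ J" if "X \<in> D1" for X
    proof -
      have "v < K" if "v \<in> wl X" for v
      proof -
        obtain Q where Q: "Q \<in> D1" "overlap X Q" "v = lev (hat Q (lca X Q))"
          using \<open>v \<in> wl X\<close> unfolding wl_def by blast
        show ?thesis using N_less[OF lev_in[OF hatF[OF \<open>X \<in> D1\<close> Q(1,2)]]] Q(3) by simp
      qed
      moreover have "0 < K" using K(2) N_less N0[OF rootF] by blast
      ultimately have "mu X < K" using mu_in[of X] by auto
      then show ?thesis using K(2) by simp
    qed
    define top where "top X j \<longleftrightarrow> j < J \<and> lev X div 2 ^ Suc j = mu X div 2 ^ Suc j \<and>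
      lev X div 2 ^ j < mu X div 2 ^ j" for X j
    \<comment> \<open>Class 0 takes the rectangles without a wall above their own level; it is
      independent, since an overlap would force equal levels against \<open>neq\<close>.\<close>
    define cl where "cl X = (if mu X \<le> lev X then 0 else Suc (SOME j. top X j))" for X
    have top: "top X (SOME j. top X j)" if "X \<in> D1" "\<not> mu X \<le> lev X" for X
    proof (rule someI_ex)
      show "\<exists>j. top X j"
        using ex_top_bit[OF _ mu_less[OF that(1)], of "lev X"] that(2) unfolding top_def not_le by blast
    qed
    show "colb D1 overlap (Suc J * bits_const)"
    proof (rule colb_split[where g=cl])
      show "cl X < Suc J" if "X \<in> D1" for X
        using top[OF that] unfolding cl_def top_def by auto
      fix i assume "i < Suc J"
      show "colb {X\<in>D1. cl X = i} overlap bits_const"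
      proof (cases i)
        case 0
        have flat: "mu X \<le> lev X" if "cl X = i" for X using that 0 unfolding cl_def by (auto split: if_splits)
        have "\<not> overlap X Y" if "X \<in> {X\<in>D1. cl X = i}" "Y \<in> {X\<in>D1. cl X = i}" for X Y
        proof
          assume o: "overlap X Y"
          then have "lev Y \<le> lev X" "lev X \<le> lev Y"
            using mu_lev[of X Y] mu_lev[of Y X] flat[of X] flat[of Y] overlap_sym[OF o] that by auto
          then show False using neq[of X Y] o that by simp
        qed
        then show ?thesis using consts_pos(3) by (intro colb_indep)
      next
        case (Suc j)
        define D2 where "D2 = {X\<in>D1. cl X = i}"
        have D2: "X \<in> D1" "top X j" if "X \<in> D2" for X
        proof -
          show "X \<in> D1" using that unfolding D2_def by simp
          have "\<not> mu X \<le> lev X" "(SOME j. top X j) = j"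
            using that Suc unfolding D2_def cl_def by (auto split: if_splits)
          then show "top X j" using top[of X] \<open>X \<in> D1\<close> by simp
        qed
        have "colb D2 overlap bits_const"
        \<comment> \<open>A level is at most the wall level of any overlapping member, and above bit
          \<open>j\<close> that agrees with the level of this member. So overlaps stay inside a
          block.\<close>
        proof (rule colb_blocks[where h="\<lambda>X. lev X div 2 ^ Suc j"])
          have le: "lev Y div 2 ^ Suc j \<le> lev X div 2 ^ Suc j" if "X \<in> D2" "Y \<in> D2" "overlap X Y" for X Y
          proof -
            have "lev Y div 2 ^ Suc j \<le> mu X div 2 ^ Suc j"
              using mu_lev[of X Y] that D2 by (intro div_le_mono) simp
            then show ?thesis using D2(2)[OF that(1)] unfolding top_def by simp
          qed
          show "lev X div 2 ^ Suc j = lev Y div 2 ^ Suc j" if "X \<in> D2" "Y \<in> D2" "overlap X Y" for X Y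
            using le[OF that] le[OF that(2,1) overlap_sym[OF that(3)]] by simp
        next
          fix \<beta>
          define D3 where "D3 = {X\<in>D2. lev X div 2 ^ Suc j = \<beta>}"
          have D3: "X \<in> D2" "lev X div 2 ^ Suc j = \<beta>" if "X \<in> D3" for X using that unfolding D3_def by auto
          have halves: "lev X div 2 ^ j = 2 * \<beta>" "mu X div 2 ^ j = 2 * \<beta> + 1" if "X \<in> D3" for X
          proof -
            have tp: "lev X div 2 ^ Suc j = mu X div 2 ^ Suc j" "lev X div 2 ^ j < mu X div 2 ^ j"
              using D2(2)[OF D3(1)[OF that]] unfolding top_def by simp_all
            have "(lev X div 2 ^ j) div 2 = \<beta>" "(mu X div 2 ^ j) div 2 = \<beta>"
              using D3(2)[OF that] tp(1) by (simp_all add: div_mult2_eq[symmetric] mult.commute)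
            then show "lev X div 2 ^ j = 2 * \<beta>" "mu X div 2 ^ j = 2 * \<beta> + 1" using tp(2) by linarith+
          qed
          \<comment> \<open>The digits above \<open>j\<close> form \<beta>; digit \<open>j\<close>
            is 0 in \<open>lev X\<close> and 1 in \<open>mu X\<close>, so \<theta> separates the
            two.\<close>
          define \<theta> where "\<theta> = (2 * \<beta> + 1) * 2 ^ j"
          have "colb D3 overlap bits_const"
          proof (rule colb_high_walls[where lev=lev and \<theta>=\<theta>])
            show "D3 \<subseteq> F" using D3(1) D2(1) D1F by blast
            show "lev X < \<theta>" if "X \<in> D3" for X
            proof -
              have "lev X div 2 ^ j < 2 * \<beta> + 1" using halves(1)[OF that] by simp
              moreover have "(0::nat) < 2 ^ j" by simp
              ultimately show ?thesis unfolding \<theta>_def using div_less_iff_less_mult by blast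
            qed
            fix X assume X: "X \<in> D3"
            then have XD1: "X \<in> D1" using D3(1) D2(1) by blast
            have th: "\<theta> \<le> mu X" using halves(2)[OF X] unfolding \<theta>_def by (metis div_times_less_eq_dividend)
            have "0 < \<theta>" unfolding \<theta>_def by simp
            then have "mu X \<in> wl X" using mu_in[of X] th by auto
            then obtain Q where Q: "Q \<in> D1" "overlap X Q" "mu X = lev (hat Q (lca X Q))"
              unfolding wl_def by blast
            have XD: "X \<in> D" "Q \<in> D" using XD1 Q(1) D1(1) by blast+
            have "\<not> (l (hat X (lca X Q)) \<le> l (hat Q (lca X Q)) \<and> r (hat Q (lca X Q)) \<le> r (hat X (lca X Q)))"
              using nonnest[OF XD(2,1) overlap_sym[OF Q(2)]] by (simp add: lca_commute[of Q X])
            then show "\<exists>Q\<in>F. overlap X Q \<and> \<theta> \<le> lev (hat Q (lca X Q)) \<and>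
              \<not> (l (hat Q (lca X Q)) \<le> l (hat X (lca X Q)) \<and> r (hat X (lca X Q)) \<le> r (hat Q (lca X Q))) \<and>
              \<not> (l (hat X (lca X Q)) \<le> l (hat Q (lca X Q)) \<and> r (hat Q (lca X Q)) \<le> r (hat X (lca X Q)))"
              using nonnest[OF XD Q(2)] Q th D1F by (intro bexI[of _ Q]) auto
          qed (use lev_mono in blast)
          then show "colb {X\<in>D2. lev X div 2 ^ Suc j = \<beta>} overlap bits_const" unfolding D3_def .
        qed
        then show ?thesis unfolding D2_def .
      qed
    qed
  qed
qed

end

section \<open>Separation of horizontal and vertical overlaps\<close>

context rect_root
begin

definition arrow :: "'a set \<Rightarrow> 'a set \<Rightarrow> bool" where
  "arrow S Q \<longleftrightarrow> overlap S Q \<and> lca S Q \<subseteq> outer S \<and> outer Q \<subset> lca S Q"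

text \<open>For the overlapping hats this means that the hat of \<open>S\<close> enters that of
  \<open>Q\<close> through its bottom or top side.\<close>

definition side_x :: "'a set \<Rightarrow> 'a set \<Rightarrow> bool" where
  "side_x S Q \<longleftrightarrow> l (hat Q (lca S Q)) < l (hat S (lca S Q)) \<and> r (hat S (lca S Q)) < r (hat Q (lca S Q))"

definition side_y :: "'a set \<Rightarrow> 'a set \<Rightarrow> bool" where
  "side_y S Q \<longleftrightarrow> b (hat Q (lca S Q)) < b (hat S (lca S Q)) \<and> t (hat S (lca S Q)) < t (hat Q (lca S Q))"

text \<open>\<open>outer Q\<close> is strictly inside \<open>lca S Q\<close>, which is therefore not
  genuine for \<open>Q\<close>. So the hat of \<open>Q\<close> has no corner in that of
  \<open>S\<close>, and \<open>no_corner\<close> applies.\<close>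

lemma arrow_side:
  assumes "S \<in> F" "Q \<in> F" "arrow S Q"
  shows "side_x S Q \<or> side_y S Q"
proof -
  have o: "overlap S Q" using assms(3) unfolding arrow_def by simp
  have "lca Q S \<notin> genuine Q"
    using outer_ge[of "lca Q S" Q] assms(3) unfolding arrow_def by (auto simp: lca_commute[of Q S])
  then have "\<not> (\<exists>c. corner_pt c (hat Q (lca S Q)) \<in> hat S (lca S Q))"
    using genuineI[OF assms(2,1) overlap_sym[OF o]] by (auto simp: lca_commute[of Q S])
  then show ?thesis
    using no_corner[OF hats(1,2,7)[OF assms(1,2) o]] unfolding side_x_def side_y_def by blast
qed

definition far :: "'a set \<Rightarrow> 'a set \<Rightarrow> bool" where
  "far S Q \<longleftrightarrow> outer S \<notin> solid (outer Q) \<and> (\<forall>L\<in>solid (outer Q). outer S \<notin> solid L)"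

text \<open>Either \<open>N\<close> is \<open>outer S\<close>, or \<open>outer S\<close> is in
  \<open>solid N\<close> by \<open>outer_solid\<close>. So \<open>N \<in> solid (outer Q)\<close>
  would lead from \<open>outer Q\<close> to \<open>outer S\<close> in at most two steps of
  \<open>solid\<close>.\<close>

lemma far_not_solid:
  assumes "S \<in> F" "genuine S \<noteq> {}" "far S Q" "N \<in> F" "S \<subseteq> N" "N \<subseteq> outer S"
  shows "N \<notin> solid (outer Q)"
proof
  assume N: "N \<in> solid (outer Q)"
  then have "N \<noteq> outer S" using assms(3) unfolding far_def by blast
  then have "outer S \<in> solid N" using assms by (intro outer_solid) auto
  then show False using assms(3) N unfolding far_def by blast
qed

text \<open>By \<open>far_not_solid\<close>, \<open>outer Q\<close> has no corner in the hat
  \<open>H\<close> of \<open>S\<close>, so it exceeds \<open>H\<close> on both sides in one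
  direction. This is the direction of the arrow: otherwise the hat of \<open>Q\<close>, which
  contains \<open>outer Q\<close>, would contain \<open>H\<close>.\<close>

lemma arrow_outer:
  assumes S: "S \<in> F" "genuine S \<noteq> {}" and Q: "Q \<in> F" "genuine Q \<noteq> {}" and a: "arrow S Q" and f: "far S Q"
  shows "overlap S (outer Q)" "side_x S Q \<Longrightarrow> l (outer Q) \<le> l S \<and> r S \<le> r (outer Q)"
    "side_y S Q \<Longrightarrow> b (outer Q) \<le> b S \<and> t S \<le> t (outer Q)"
proof -
  define N A H V where "N = lca S Q" and "A = outer Q" and "H = hat S (lca S Q)" and "V = hat Q (lca S Q)"
  have o: "overlap S Q" and up: "N \<subseteq> outer S" and AN: "A \<subset> N"
    using a unfolding arrow_def N_def A_def by simp_all
  have AF: "A \<in> F" "Q \<subseteq> A" using outer_F[OF Q] unfolding A_def by auto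
  note h = hats[OF S(1) Q(1) o, folded H_def V_def N_def]
  have NF: "N \<in> F" "S \<subseteq> N" using lca_in[OF S(1) Q(1)] lca_sup(1) unfolding N_def by auto
  have SN: "S \<subset> N" using lca_psup(1)[OF o] unfolding N_def .
  show "overlap S (outer Q)"
    using overlap_up(1)[OF S(1) Q(1) o, of S A] S(1) SN AN AF unfolding N_def A_def by blast
  have HA: "overlap H A" "lca H A = N"
    using overlap_up[OF S(1) Q(1) o, of H A] h(1,3,5) AN AF unfolding N_def by auto
  have "N \<notin> solid A" unfolding A_def by (rule far_not_solid[OF S f NF up])
  then have "\<not> (\<exists>c. corner_pt c A \<in> H)"
    using HA h(1) overlap_sym[OF HA(1)] unfolding solid_def by (auto simp: lca_commute[of H A])
  then have side: "l A < l H \<and> r H < r A \<or> b A < b H \<and> t H < t A" using no_corner[OF h(1) AF(1) HA(1)] by blast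
  have AV: "A \<subseteq> V" unfolding V_def using hat_sub[OF AF] AN unfolding N_def by blast
  have HV: "\<not> H \<subseteq> V" using h(7) unfolding overlap_def by blast
  have SH: "S \<subseteq> H" by (rule h(3))
  note ineqs = AV[unfolded rect_subset[OF AF(1) h(2)]] HV[unfolded rect_subset[OF h(1,2)]]
    SH[unfolded rect_subset[OF S(1) h(1)]]
  show "l (outer Q) \<le> l S \<and> r S \<le> r (outer Q)" if "side_x S Q"
    using that side ineqs unfolding side_x_def A_def[symmetric] H_def[symmetric] V_def[symmetric] by linarith
  show "b (outer Q) \<le> b S \<and> t S \<le> t (outer Q)" if "side_y S Q"
    using that side ineqs unfolding side_y_def A_def[symmetric] H_def[symmetric] V_def[symmetric] by linarith
qed

text \<open>If \<open>S\<close> had arrows of both kinds, to \<open>Q\<^sub>1\<close> and \<open>Q\<^sub>2\<close>, then \<open>outer Q\<^sub>1\<close> and \<open>outer Q\<^sub>2\<close> would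
  overlap inside the larger of the two nodes, and one of them would have a corner in the other.\<close>

lemma arrow_clash:
  assumes S: "S \<in> F" "genuine S \<noteq> {}" and Q: "Q \<in> F" "genuine Q \<noteq> {}" "arrow S Q" "far S Q" "side_y S Q"
    and P: "P \<in> F" "genuine P \<noteq> {}" "arrow S P" "far S P" "side_x S P"
  shows False
proof -
  define A B N where "A = outer Q" and "B = outer P" and "N = lca A B"
  have A: "A \<in> F" "Q \<subseteq> A" "A \<subset> lca S Q" "lca S Q \<subseteq> outer S"
    using outer_F[OF Q(1,2)] Q(3) unfolding A_def arrow_def by auto
  have B: "B \<in> F" "P \<subseteq> B" "B \<subset> lca S P" "lca S P \<subseteq> outer S"
    using outer_F[OF P(1,2)] P(3) unfolding B_def arrow_def by auto
  note a = arrow_outer[OF S Q(1-4)] and p = arrow_outer[OF S P(1-4)]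
  have oA: "overlap S A" and oB: "overlap S B" using a(1) p(1) unfolding A_def B_def .
  have yA: "b A \<le> b S" "t S \<le> t A" and xB: "l B \<le> l S" "r S \<le> r B"
    using a(3)[OF Q(5)] p(2)[OF P(5)] unfolding A_def B_def by simp_all
  note rA = oA[unfolded rect_overlap[OF S(1) A(1)]] and rB = oB[unfolded rect_overlap[OF S(1) B(1)]]
  \<comment> \<open>\<open>A\<close> spans \<open>S\<close> vertically but not horizontally,
    \<open>B\<close> the other way round. So they meet near \<open>S\<close> and are
    incomparable.\<close>
  have oAB: "overlap A B"
    unfolding rect_overlap[OF A(1) B(1)] using rA rB yA xB by linarith
  have NF: "N \<in> F" and subN: "A \<subseteq> N" "B \<subseteq> N"
    using lca_in[OF A(1) B(1)] lca_sup(1)[of A B] lca_sup(2)[of B A] unfolding N_def by blast+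
  have SN: "S \<subseteq> N"
    using subN yA xB unfolding rect_subset[OF A(1) NF] rect_subset[OF B(1) NF] rect_subset[OF S(1) NF]
    by linarith
  have L: "lca S Q \<in> F" "lca S P \<in> F" "S \<subseteq> lca S Q" "S \<subseteq> lca S P"
    using lca_in S(1) Q(1) P(1) lca_sup(1) by blast+
  then consider "lca S Q \<subseteq> lca S P" | "lca S P \<subseteq> lca S Q" using containers_chain[OF S(1)] by blast
  then have "N \<subseteq> outer S"
  proof cases
    case 1
    then have "N \<subseteq> lca S P" unfolding N_def using A(3) B(3) by (intro lca_least[OF L(2)]) blast+
    then show ?thesis using B(4) by blast
  next
    case 2
    then have "N \<subseteq> lca S Q" unfolding N_def using A(3) B(3) by (intro lca_least[OF L(1)]) blast+
    then show ?thesis using A(4) by blast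
  qed
  then have "N \<notin> solid A" "N \<notin> solid B"
    using far_not_solid[OF S Q(4) NF SN] far_not_solid[OF S P(4) NF SN] unfolding A_def B_def by blast+
  moreover have "N \<in> solid A \<or> N \<in> solid B"
    using corner[OF A(1) B(1) oAB] A(1) B(1) oAB overlap_sym[OF oAB]
    unfolding solid_def N_def by (auto simp: lca_commute[of A B])
  ultimately show False by blast
qed

text \<open>It depends on \<open>w\<close> alone, not on the family or the coordinates, so
  \<open>clean_const\<close> can use it outside the locale.\<close>

definition noncross_const :: nat where
  "noncross_const = sep_const * (wall_const * (2 * (line_const w * bits_const)))"

text \<open>After the separation and the removal of overlaps inside a common hat, every overlap is
  an arrow. By \<open>arrow_clash\<close> members with a vertical arrow send no horizontal one, so
  two classes remain. In each the hats are not nested in one direction, since such nesting would be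
  a containment or a crossing; \<open>colb_bits\<close> applies directly or with the axes
  exchanged.\<close>

lemma colb_noncross:
  assumes K: "2 * card F < 2 ^ K" "K < 2 ^ J"
  shows "colb F overlap (noncross_const * Suc J)"
proof -
  have "colb F overlap (sep_const * (wall_const * (2 * (line_const w * (Suc J * bits_const)))))"
  proof (rule colb_separation)
    show "0 < wall_const * (2 * (line_const w * (Suc J * bits_const)))" using consts_pos by simp
    fix D
    assume D: "D \<subseteq> F" "\<And>S. S \<in> D \<Longrightarrow> genuine S \<noteq> {}"
      and far: "\<And>S Q. S \<in> D \<Longrightarrow> Q \<in> D \<Longrightarrow>
         outer S \<notin> solid (outer Q) \<and> (\<forall>L\<in>solid (outer Q). outer S \<notin> solid L)"
      and cases: "\<And>S Q. S \<in> D \<Longrightarrow> Q \<in> D \<Longrightarrow> overlap S Q \<Longrightarrow> hat S (outer S) = hat Q (outer Q) \<or>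
         lca S Q \<subseteq> outer S \<and> outer Q \<subset> lca S Q \<or> lca S Q \<subseteq> outer Q \<and> outer S \<subset> lca S Q"
    have DF: "X \<in> F" if "X \<in> D" for X using D(1) that by blast
    have c1: "colb D (\<lambda>X Y. overlap X Y \<and> hat X (outer X) = hat Y (outer Y)) wall_const"
    proof (rule colb_corner_walls)
      fix X assume "X \<in> D"
      from outer_wall_hat[OF DF[OF this] D(2)[OF this]] DF[OF this]
      show "X \<in> F \<and> hat X (outer X) \<in> F \<and> X \<subseteq> hat X (outer X) \<and>
        (\<exists>V\<in>F. \<exists>c. overlap (hat X (outer X)) V \<and> corner_pt c (hat X (outer X)) \<in> V \<and> V \<inter> X \<noteq> {})"
        by simp
    qed
    show "colb D overlap (wall_const * (2 * (line_const w * (Suc J * bits_const))))"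
    proof (rule colb_refine[OF c1])
      fix D1 assume D1: "D1 \<subseteq> D"
        "\<And>X Y. X \<in> D1 \<Longrightarrow> Y \<in> D1 \<Longrightarrow> \<not> (overlap X Y \<and> hat X (outer X) = hat Y (outer Y))"
      have D1D: "X \<in> D" if "X \<in> D1" for X using D1(1) that by blast
      note D1F = DF[OF D1D]
      have orient: "arrow S Q \<or> arrow Q S" if "S \<in> D1" "Q \<in> D1" "overlap S Q" for S Q
        using cases[OF D1D[OF that(1)] D1D[OF that(2)] that(3)] D1(2)[OF that(1,2)] that(3)
          overlap_sym[OF that(3)] unfolding arrow_def by (auto simp: lca_commute[of Q S])
      define hor where "hor S \<longleftrightarrow> (\<exists>Q\<in>D1. arrow S Q \<and> side_y S Q)" for S
      have no_x: "\<not> side_x S P" if "hor S" "S \<in> D1" "P \<in> D1" "arrow S P" for S P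
      proof
        assume x: "side_x S P"
        obtain Q where Q: "Q \<in> D1" "arrow S Q" "side_y S Q" using \<open>hor S\<close> unfolding hor_def by blast
        have f: "far S U" if "U \<in> D1" for U
          using far[OF D1D[OF \<open>S \<in> D1\<close>] D1D[OF that]] unfolding far_def .
        show False
          using arrow_clash[OF D1F[OF that(2)] D(2)[OF D1D[OF that(2)]] D1F[OF Q(1)] D(2)[OF D1D[OF Q(1)]]
            Q(2) f[OF Q(1)] Q(3) D1F[OF that(3)] D(2)[OF D1D[OF that(3)]] that(4) f[OF that(3)] x] .
      qed
      show "colb D1 overlap (2 * (line_const w * (Suc J * bits_const)))"
      proof (rule colb_split[where g="\<lambda>S. if hor S then 0 else 1"])
        fix i :: nat assume "i < 2"
        then consider "i = 0" | "i = 1" by linarith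
        then show "colb {S\<in>D1. (if hor S then 0 else 1) = i} overlap (line_const w * (Suc J * bits_const))"
        proof cases
          case 1
          show ?thesis
          proof (rule colb_bits[OF _ _ K])
            fix S Q assume S: "S \<in> {S\<in>D1. (if hor S then 0 else 1) = i}"
              and Q: "Q \<in> {S\<in>D1. (if hor S then 0 else 1) = i}" and o: "overlap S Q"
            have SD: "S \<in> D1" "Q \<in> D1" "hor S" "hor Q" using S Q 1 by (auto split: if_splits)
            note h = hats[OF D1F[OF SD(1)] D1F[OF SD(2)] o]
            have n: "\<not> thin (hat S (lca S Q)) (hat Q (lca S Q))" "\<not> hat S (lca S Q) \<subseteq> hat Q (lca S Q)"
              using noncross[OF h(1,2,7)] h(7) unfolding overlap_def by blast+
            have "arrow S Q \<and> side_y S Q \<or> arrow Q S \<and> side_y Q S"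
              using orient[OF SD(1,2) o] arrow_side[OF D1F[OF SD(1)] D1F[OF SD(2)]]
                arrow_side[OF D1F[OF SD(2)] D1F[OF SD(1)]]
                no_x[OF SD(3,1,2)] no_x[OF SD(4,2,1)] by satx
            then show "\<not> (l (hat Q (lca S Q)) \<le> l (hat S (lca S Q)) \<and> r (hat S (lca S Q)) \<le> r (hat Q (lca S Q)))"
              using n unfolding side_y_def thin_def rect_subset[OF h(1,2)] lca_commute[of Q S] by auto
          qed (use D1F in auto)
        next
          case 2
          have eq: "{S\<in>D1. (if hor S then 0 else 1) = i} = {S\<in>D1. \<not> hor S}"
            unfolding 2 by (rule Collect_cong) simp
          interpret sw: rect_root F w py px "\<lambda>x y. pt y x" b t l r Om by (rule rect_root_swap)
          show ?thesis unfolding eq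
          proof (rule sw.colb_bits[OF _ _ K])
            fix S Q assume S: "S \<in> {S\<in>D1. \<not> hor S}" and Q: "Q \<in> {S\<in>D1. \<not> hor S}" and o: "overlap S Q"
            then have SD: "S \<in> D1" "Q \<in> D1" "\<not> hor S" "\<not> hor Q" by blast+
            note h = hats[OF D1F[OF SD(1)] D1F[OF SD(2)] o]
            have n: "\<not> thin (hat Q (lca S Q)) (hat S (lca S Q))" "\<not> hat S (lca S Q) \<subseteq> hat Q (lca S Q)"
              using noncross[OF h(2,1) overlap_sym[OF h(7)]] h(7) unfolding overlap_def by blast+
            have "\<not> (arrow S Q \<and> side_y S Q)" "\<not> (arrow Q S \<and> side_y Q S)"
              using SD unfolding hor_def by blast+
            then have "arrow S Q \<and> side_x S Q \<or> arrow Q S \<and> side_x Q S"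
              using orient[OF SD(1,2) o] arrow_side[OF D1F[OF SD(1)] D1F[OF SD(2)]]
                arrow_side[OF D1F[OF SD(2)] D1F[OF SD(1)]] by satx
            then show "\<not> (b (hat Q (lca S Q)) \<le> b (hat S (lca S Q)) \<and> t (hat S (lca S Q)) \<le> t (hat Q (lca S Q)))"
              using n unfolding side_x_def thin_def rect_subset[OF h(1,2)] lca_commute[of Q S] by auto
          qed (use D1F in auto)
        qed
      qed auto
    qed
  qed
  then show ?thesis unfolding noncross_const_def by (simp only: mult_ac)
qed

end

section \<open>The bound for clean families\<close>

definition clean_const :: "nat \<Rightarrow> nat" where
  "clean_const w = w * rect_root.noncross_const w"

text \<open>\<open>colb_thin\<close> removes the crossings at the cost of a factor \<open>w\<close>.
  Each class then gets its bounding box as root, which explains \<open>Suc (card F)\<close>.\<close>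

lemma colb_clean:
  fixes F :: "(real \<times> real) set set"
  assumes fin: "finite F" and R: "\<And>A. A \<in> F \<Longrightarrow> rectangle A" and clean: "clean_family F"
    and cliq: "cliques_le F w" and K: "2 * Suc (card F) < 2 ^ K" "K < 2 ^ J"
  shows "colb F overlap (clean_const w * Suc J)"
proof -
  have "\<forall>A. \<exists>q. A \<in> F \<longrightarrow> (case q of (l, r, b, t) \<Rightarrow> l \<le> r \<and> b \<le> t \<and> A = {l..r} \<times> {b..t})"
  proof
    fix A
    show "\<exists>q. A \<in> F \<longrightarrow> (case q of (l, r, b, t) \<Rightarrow> l \<le> r \<and> b \<le> t \<and> A = {l..r} \<times> {b..t})"
    proof (cases "A \<in> F")
      case True
      then obtain x0 x1 y0 y1 where "x0 < x1" "y0 < y1" "A = {x0..x1} \<times> {y0..y1}"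
        using R unfolding rectangle_def by meson
      then show ?thesis by (intro exI[of _ "(x0, x1, y0, y1)"]) simp
    qed simp
  qed
  from choice[OF this] obtain q where
    q: "\<forall>A. A \<in> F \<longrightarrow> (case q A of (l, r, b, t) \<Rightarrow> l \<le> r \<and> b \<le> t \<and> A = {l..r} \<times> {b..t})" ..
  define l r b t where "l A = fst (q A)" and "r A = fst (snd (q A))"
    and "b A = fst (snd (snd (q A)))" and "t A = snd (snd (snd (q A)))" for A
  have q': "l A \<le> r A" "b A \<le> t A" "A = {l A..r A} \<times> {b A..t A}" if "A \<in> F" for A
    using q[THEN spec, of A] that unfolding l_def r_def b_def t_def by (auto split: prod.splits)
  interpret rf: rect_family F w fst snd Pair l r b t
  proof
    show "A = {p. l A \<le> fst p \<and> fst p \<le> r A \<and> b A \<le> snd p \<and> snd p \<le> t A}" if "A \<in> F" for A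
    proof -
      have "{l A..r A} \<times> {b A..t A} = {p. l A \<le> fst p \<and> fst p \<le> r A \<and> b A \<le> snd p \<and> snd p \<le> t A}"
        by auto
      with q'(3)[OF that] show ?thesis by (rule trans)
    qed
  qed (use fin clean cliq q' in auto)
  have "colb F overlap (w * (rect_root.noncross_const w * Suc J))"
  proof (rule colb_refine[OF rf.colb_thin])
    fix D assume D: "D \<subseteq> F" "\<And>A B. A \<in> D \<Longrightarrow> B \<in> D \<Longrightarrow> \<not> (overlap A B \<and> (rf.thin A B \<or> rf.thin B A))"
    show "colb D overlap (rect_root.noncross_const w * Suc J)"
    proof (cases "D = {}")
      case True
      then show ?thesis by (auto intro: colbI)
    next
      case False
      have DF: "A \<in> F" if "A \<in> D" for A using D(1) that by blast
      have finD: "finite D" using D(1) fin by (rule finite_subset)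
      obtain A0 where A0: "A0 \<in> D" using False by blast
      define x0 x1 y0 y1 where "x0 = Min (l ` D)" and "x1 = Max (r ` D)" and "y0 = Min (b ` D)" and "y1 = Max (t ` D)"
      have bd: "x0 \<le> l A" "r A \<le> x1" "y0 \<le> b A" "t A \<le> y1" if "A \<in> D" for A
        unfolding x0_def x1_def y0_def y1_def using finD that by auto
      define Om where "Om = {x0..x1} \<times> {y0..y1}"
      define F' where "F' = insert Om D"
      have sub: "A \<subseteq> Om" if "A \<in> F'" for A
      proof (cases "A = Om")
        case False
        then have AD: "A \<in> D" using that unfolding F'_def by blast
        have "{l A..r A} \<times> {b A..t A} \<subseteq> Om"
          unfolding Om_def using bd[OF AD] by (intro Sigma_mono) (auto simp: atLeastatMost_subset_iff)
        then show ?thesis using q'(3)[OF DF[OF AD]] by simp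
      qed simp
      have inD: "A \<in> D \<and> A \<noteq> Om" "B \<in> D \<and> B \<noteq> Om" if "A \<in> F'" "B \<in> F'" "overlap A B" for A B
        using that sub[OF that(1)] sub[OF that(2)] unfolding F'_def overlap_def by blast+
      \<comment> \<open>The chosen coordinates describe members of \<open>F\<close> only, so those
        of the root are set by hand.\<close>
      define l' r' b' t' where "l' = l(Om := x0)" and "r' = r(Om := x1)" and "b' = b(Om := y0)" and "t' = t(Om := y1)"
      have A0b: "x0 \<le> x1" "y0 \<le> y1" using bd[OF A0] q'(1,2)[OF DF[OF A0]] by linarith+
      have w: "0 < w" using cliques_leD[OF cliq, of "{A0}"] DF[OF A0] by simp
      have cleanD: "clean_family D" by (rule clean_family_subset[OF clean D(1)])
      interpret r0: rect_family F' w fst snd Pair l' r' b' t'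
      proof (unfold_locales)
        show "finite F'" using finD unfolding F'_def by simp
        show "clean_family F'" unfolding clean_family_def
        proof clarify
          fix A B S assume *: "A \<in> F'" "B \<in> F'" "S \<in> F'" "overlap A B" "S \<subseteq> A" "S \<subseteq> B"
          note AB = inD[OF *(1,2,4)]
          have "S \<noteq> Om" using AB sub[OF *(1)] *(5) by auto
          then have "S \<in> D" using *(3) unfolding F'_def by simp
          then show False using clean_familyD[OF cleanD _ _ _ *(4-6)] AB by simp
        qed
        show "cliques_le F' w" unfolding cliques_le_def
        proof (intro allI impI)
          fix K assume K: "K \<subseteq> F'" "\<forall>A\<in>K. \<forall>B\<in>K. A \<noteq> B \<longrightarrow> overlap A B"
          show "card K \<le> w"
          proof (cases "Om \<in> K")
            case True
            have "A = Om" if "A \<in> K" for A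
            proof (rule ccontr)
              assume "A \<noteq> Om"
              then have "overlap A Om" using K(2) that True by blast
              then show False using sub[of A] K(1) that unfolding overlap_def by blast
            qed
            then have "K \<subseteq> {Om}" by blast
            then have "card K \<le> 1" using card_mono[of "{Om}" K] by simp
            then show ?thesis using w by simp
          next
            case False
            then have "K \<subseteq> F" using K(1) D(1) unfolding F'_def by blast
            then show ?thesis using cliques_leD[OF cliq] K(2) by simp
          qed
        qed
        fix A assume A: "A \<in> F'"
        show "A = {p. l' A \<le> fst p \<and> fst p \<le> r' A \<and> b' A \<le> snd p \<and> snd p \<le> t' A}"
        proof (cases "A = Om")
          case True
          then show ?thesis unfolding l'_def r'_def b'_def t'_def Om_def by auto
        next
          case False
          then show ?thesis using A rf.rect[of A] DF[of A] unfolding l'_def r'_def b'_def t'_def F'_def by auto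
        qed
        show "l' A \<le> r' A" "b' A \<le> t' A"
          using A A0b q'(1,2)[OF DF[of A]] unfolding l'_def r'_def b'_def t'_def F'_def by auto
      qed simp_all
      interpret rr: rect_root F' w fst snd Pair l' r' b' t' Om
      proof
        fix A B assume "A \<in> F'" "B \<in> F'" and o: "overlap A B"
        note AB = inD[OF this]
        have "\<not> rf.thin A B" using D(2)[of A B] AB o by blast
        then show "\<not> r0.thin A B"
          using AB unfolding rf.thin_def r0.thin_def unfolding l'_def r'_def b'_def t'_def by simp
      qed (use sub in \<open>auto simp: F'_def\<close>)
      have "card F' \<le> Suc (card F)"
        using card_mono[OF fin D(1)] finD unfolding F'_def by (simp add: card_insert_if)
      then have "2 * card F' \<le> 2 * Suc (card F)" by simp
      then have "2 * card F' < 2 ^ K" using K(1) by (rule le_less_trans)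
      then have "colb F' overlap (rr.noncross_const * Suc J)" using K(2) by (rule rr.colb_noncross)
      then show ?thesis by (rule colb_mono) (auto simp: F'_def)
    qed
  qed
  then show ?thesis unfolding clean_const_def by (simp only: mult.assoc)
qed

section \<open>Reduction to clean families\<close>

primrec nest :: "'a set set \<Rightarrow> nat \<Rightarrow> 'a set set" where
  "nest F 0 = F"
| "nest F (Suc k) = {S\<in>F. \<exists>A\<in>nest F k. \<exists>B\<in>nest F k. overlap A B \<and> S \<subseteq> A \<and> S \<subseteq> B}"

lemma nest_sub: "nest F k \<subseteq> F"
  by (cases k) auto

declare nest.simps(2) [simp del]

lemma nest_Suc_sub: "nest F (Suc k) \<subseteq> nest F k"
proof (induction k)
  case (Suc k)
  show ?case
  proof
    fix S assume "S \<in> nest F (Suc (Suc k))"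
    then obtain A B where "S \<in> F" "A \<in> nest F (Suc k)" "B \<in> nest F (Suc k)" "overlap A B" "S \<subseteq> A" "S \<subseteq> B"
      unfolding nest.simps(2)[of F "Suc k"] by blast
    then show "S \<in> nest F (Suc k)" using Suc unfolding nest.simps(2)[of F k] by blast
  qed
qed (auto simp: nest.simps(2))

lemma nest_mono: "i \<le> j \<Longrightarrow> nest F j \<subseteq> nest F i"
  by (rule lift_Suc_antimono_le[of "nest F"]) (rule nest_Suc_sub)

lemma nest_down: "S \<in> F \<Longrightarrow> A \<in> nest F k \<Longrightarrow> S \<subseteq> A \<Longrightarrow> S \<in> nest F k"
  by (cases k) (auto simp: nest.simps(2), meson subset_trans)

text \<open>A maximal member of \<open>nest F k\<close> lies in no two overlapping ones, so each
  step loses a member. Thus every \<open>level\<close> is finite.\<close>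

lemma card_nest: "finite F \<Longrightarrow> card (nest F k) \<le> card F - k"
proof (induction k)
  case (Suc k)
  have fin: "finite (nest F k)" using nest_sub Suc.prems by (rule finite_subset)
  show ?case
  proof (cases "nest F k = {}")
    case True
    then have "nest F (Suc k) = {}" by (simp add: nest.simps(2))
    then show ?thesis by simp
  next
    case False
    obtain M where M: "M \<in> nest F k" "\<And>A. A \<in> nest F k \<Longrightarrow> M \<subseteq> A \<Longrightarrow> M = A"
      using finite_has_maximal[OF fin False] by blast
    have "M \<notin> nest F (Suc k)"
    proof
      assume "M \<in> nest F (Suc k)"
      then obtain A B where "A \<in> nest F k" "B \<in> nest F k" "overlap A B" "M \<subseteq> A" "M \<subseteq> B"
        unfolding nest.simps(2) by blast
      then show False using M(2)[of A] M(2)[of B] overlap_irrefl[of M] by simp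
    qed
    then have "nest F (Suc k) \<subset> nest F k" using nest_Suc_sub M(1) by blast
    then have "card (nest F (Suc k)) < card (nest F k)" by (rule psubset_card_mono[OF fin])
    then show ?thesis using Suc by linarith
  qed
qed simp

definition level :: "'a set set \<Rightarrow> 'a set \<Rightarrow> nat" where
  "level F S = (LEAST k. S \<notin> nest F (Suc k))"

lemma nest_level:
  assumes "finite F" "S \<in> F"
  shows "S \<in> nest F k \<longleftrightarrow> k \<le> level F S"
proof -
  have "card (nest F (Suc (card F))) = 0" using card_nest[OF assms(1), of "Suc (card F)"] by linarith
  moreover have "finite (nest F (Suc (card F)))" using nest_sub assms(1) by (rule finite_subset)
  ultimately have "S \<notin> nest F (Suc (card F))" by auto
  then have out: "S \<notin> nest F (Suc (level F S))" unfolding level_def by (rule LeastI)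
  have "S \<in> nest F (level F S)"
  proof (cases "level F S")
    case (Suc j)
    then have "j < (LEAST k. S \<notin> nest F (Suc k))" unfolding level_def by simp
    then show ?thesis using not_less_Least unfolding Suc by blast
  qed (use assms in simp)
  then show ?thesis using out nest_mono[of k "level F S" F] nest_mono[of "Suc (level F S)" k F]
    by (meson not_less_eq_eq subsetD)
qed

text \<open>Two overlapping members of level \<open>k\<close> that contain \<open>S\<close> put
  \<open>S\<close> into \<open>nest F (Suc k)\<close>, that is, on a deeper level.\<close>

lemma clean_level:
  assumes "finite F"
  shows "clean_family {S\<in>F. level F S = k}"
  unfolding clean_family_def
proof (rule notI, elim bexE conjE)
  fix A B S
  assume L: "A \<in> {S\<in>F. level F S = k}" "B \<in> {S\<in>F. level F S = k}" "S \<in> {S\<in>F. level F S = k}"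
    and o: "overlap A B" "S \<subseteq> A" "S \<subseteq> B"
  then have *: "A \<in> F" "B \<in> F" "level F A = level F S" "level F B = level F S" "S \<in> F" by simp_all
  then have "A \<in> nest F (level F S)" "B \<in> nest F (level F S)" by (simp_all add: nest_level[OF assms])
  then have "S \<in> nest F (Suc (level F S))" using * o unfolding nest.simps(2) by blast
  then show False by (simp add: nest_level[OF assms *(5)])
qed

text \<open>When the levels of overlapping members differ by at least \<open>2\<close>, the deepest member of a clique
  can be replaced by the two overlapping members that contain it.\<close>

lemma cliques_le_levels:
  assumes fin: "finite F" and cliq: "cliques_le F (Suc v)" and v: "0 < v" and D: "D \<subseteq> F"
    and far: "\<And>A B. A \<in> D \<Longrightarrow> B \<in> D \<Longrightarrow> overlap A B \<Longrightarrow>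
      Suc (level F A) < level F B \<or> Suc (level F B) < level F A"
  shows "cliques_le D v"
  unfolding cliques_le_def
proof (intro allI impI)
  fix K assume K: "K \<subseteq> D" "\<forall>A\<in>K. \<forall>B\<in>K. A \<noteq> B \<longrightarrow> overlap A B"
  have finK: "finite K" using K(1) D fin by (meson finite_subset)
  show "card K \<le> v"
  proof (cases "card K \<le> 1")
    case True
    then show ?thesis using v by simp
  next
    case False
    then have "K \<noteq> {}" by auto
    then have "Max (level F ` K) \<in> level F ` K" using finK by (intro Max_in) simp_all
    then obtain S where SK: "S \<in> K" "Max (level F ` K) = level F S" by blast
    have S: "S \<in> K" "level F A \<le> level F S" if "A \<in> K" for A
      using SK(1) finK that unfolding SK(2)[symmetric] by simp_all
    note S = SK(1) S(2)
    have KF: "A \<in> F" if "A \<in> K" for A using that K(1) D by blast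
    have low: "Suc (level F A) < level F S" if "A \<in> K - {S}" for A
    proof -
      have A: "A \<in> K" "A \<noteq> S" using that by auto
      have "overlap A S" using K(2) A S(1) by blast
      then have "Suc (level F A) < level F S \<or> Suc (level F S) < level F A"
        using far[of A S] K(1) A(1) S(1) by (meson subsetD)
      then show ?thesis using S(2)[OF A(1)] by linarith
    qed
    have "K - {S} \<noteq> {}"
    proof
      assume "K - {S} = {}"
      then have "K = {S}" using S(1) by blast
      then show False using False by simp
    qed
    then obtain A0 where "A0 \<in> K - {S}" by blast
    \<comment> \<open>The level of \<open>A0\<close> is at least 0, so that of \<open>S\<close> is
      at least 2 and the subtraction is exact.\<close>
    from low[OF this] have m: "level F S = Suc (Suc m)" if "m = level F S - 2" for m using that by simp
    define m where "m = level F S - 2"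
    note m = m[OF m_def]
    then have "S \<in> nest F (Suc (Suc m))" using nest_level[OF fin KF[OF S(1)]] by simp
    then obtain A B where AB: "A \<in> nest F (Suc m)" "B \<in> nest F (Suc m)" "overlap A B" "S \<subseteq> A" "S \<subseteq> B"
      unfolding nest.simps(2)[of F "Suc m"] by blast
    have ABF: "A \<in> F" "B \<in> F" using AB(1,2) nest_sub by blast+
    \<comment> \<open>\<open>X\<close> has level at most \<open>m\<close>, so it is not inside the
      deeper \<open>U\<close>; the rest is inherited from the overlap of \<open>X\<close> with
      \<open>S\<close>.\<close>
    have ov: "overlap X U" if X: "X \<in> K - {S}" and U: "U \<in> nest F (Suc m)" "S \<subseteq> U" for X U
    proof -
      have "X \<notin> nest F (Suc m)" using nest_level[OF fin, of X "Suc m"] low[OF X] m KF X by simp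
      then have "\<not> X \<subseteq> U" using nest_down[OF _ U(1)] KF X by blast
      moreover have "overlap X S" using K(2) X S(1) by blast
      ultimately show ?thesis using U(2) unfolding overlap_def by blast
    qed
    define K' where "K' = insert A (insert B (K - {S}))"
    have "A \<notin> K - {S}" "B \<notin> K - {S}" using ov AB overlap_irrefl by blast+
    moreover have "A \<noteq> B" using AB(3) overlap_irrefl by blast
    ultimately have "card K' = Suc (Suc (card (K - {S})))" using finK unfolding K'_def by simp
    moreover have "card (K - {S}) = card K - 1" using S(1) finK by simp
    moreover have "card K' \<le> Suc v"
    proof (rule cliques_leD[OF cliq])
      show "K' \<subseteq> F" using KF ABF unfolding K'_def by blast
      have o: "overlap X A" "overlap A X" "overlap X B" "overlap B X" if "X \<in> K - {S}" for X
        using ov[OF that AB(1,4)] ov[OF that AB(2,5)] overlap_sym by blast+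
      fix X Y assume "X \<in> K'" "Y \<in> K'" "X \<noteq> Y"
      then show "overlap X Y" unfolding K'_def
        by (elim insertE) (use o AB(3) overlap_sym[OF AB(3)] K(2) in simp_all)
    qed
    ultimately show ?thesis using False by linarith
  qed
qed

text \<open>Clique number 1 means no overlaps and one colour; starting the recursion there yields
  the exponent \<open>w - 1\<close>.\<close>

primrec gen_const :: "nat \<Rightarrow> nat" where
  "gen_const 0 = 1"
| "gen_const (Suc v) = (if v = 0 then 1 else 2 * (clean_const (Suc v) * gen_const v))"

text \<open>Overlaps within a level cost one factor \<open>Suc J\<close> by
  \<open>colb_clean\<close>. Fixing the parity makes the remaining levels differ by at least 2, so
  \<open>cliques_le_levels\<close> lowers the clique number and induction applies.\<close>

lemma colb_rectangles:
  fixes F :: "(real \<times> real) set set"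
  assumes "finite F" "\<And>A. A \<in> F \<Longrightarrow> rectangle A" "cliques_le F w" "2 * Suc (card F) < 2 ^ K" "K < 2 ^ J"
  shows "colb F overlap (gen_const w * Suc J ^ (w - 1))"
  using assms
proof (induction w arbitrary: F)
  case 0
  have "F = {}"
  proof (rule ccontr)
    assume "F \<noteq> {}"
    then obtain A where "A \<in> F" by blast
    then show False using cliques_leD[OF "0.prems"(3), of "{A}"] by simp
  qed
  then show ?case by (auto intro: colbI)
next
  case (Suc v)
  show ?case
  proof (cases "v = 0")
    case True
    have "\<not> overlap A B" if "A \<in> F" "B \<in> F" for A B
    proof
      assume o: "overlap A B"
      then have "A \<noteq> B" using overlap_irrefl by blast
      moreover have "card {A, B} \<le> Suc v"
        by (rule cliques_leD[OF Suc.prems(3)]) (use that o overlap_sym[OF o] in auto)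
      ultimately show False using True by simp
    qed
    then show ?thesis using True by (intro colb_indep) auto
  next
    case False
    note fin = Suc.prems(1)
    have bound: "2 * Suc (card F') < 2 ^ K" if "F' \<subseteq> F" for F'
      by (rule le_less_trans[OF _ Suc.prems(4)]) (use card_mono[OF fin that] in simp)
    have "colb F overlap (2 * ((clean_const (Suc v) * Suc J) * (gen_const v * Suc J ^ (v - 1))))"
    proof (rule colb_split[where g="\<lambda>S. level F S mod 2"])
      fix i :: nat
      define D where "D = {S\<in>F. level F S mod 2 = i}"
      have c1: "colb D (\<lambda>A B. overlap A B \<and> level F A = level F B) (clean_const (Suc v) * Suc J)"
      proof (rule colb_blocks[where h="level F"])
        fix k
        define L where "L = {S\<in>F. level F S = k}"
        have L: "L \<subseteq> F" unfolding L_def by blast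
        have "colb L overlap (clean_const (Suc v) * Suc J)"
        proof (rule colb_clean)
          show "finite L" using L fin by (rule finite_subset)
          show "clean_family L" unfolding L_def by (rule clean_level[OF fin])
          show "cliques_le L (Suc v)" by (rule cliques_le_subset[OF Suc.prems(3) L])
        qed (use L Suc.prems(2,5) bound[OF L] in auto)
        then show "colb {S\<in>D. level F S = k} (\<lambda>A B. overlap A B \<and> level F A = level F B)
            (clean_const (Suc v) * Suc J)"
          by (rule colb_mono) (auto simp: L_def D_def)
      qed simp
      have "colb D overlap ((clean_const (Suc v) * Suc J) * (gen_const v * Suc J ^ (v - 1)))"
      proof (rule colb_refine[OF c1])
        fix D' assume D': "D' \<subseteq> D" "\<And>A B. A \<in> D' \<Longrightarrow> B \<in> D' \<Longrightarrow> \<not> (overlap A B \<and> level F A = level F B)"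
        have DF: "D' \<subseteq> F" using D'(1) unfolding D_def by blast
        show "colb D' overlap (gen_const v * Suc J ^ (v - 1))"
        proof (rule Suc.IH)
          show "finite D'" using DF fin by (rule finite_subset)
          show "cliques_le D' v"
          proof (rule cliques_le_levels[OF fin Suc.prems(3) _ DF])
            fix A B assume AB: "A \<in> D'" "B \<in> D'" "overlap A B"
            then have "level F A \<noteq> level F B" "level F A mod 2 = level F B mod 2"
              using D' unfolding D_def by auto
            then show "Suc (level F A) < level F B \<or> Suc (level F B) < level F A" by presburger
          qed (use False in simp)
        qed (use DF Suc.prems(2,5) bound[OF DF] in auto)
      qed
      then show "colb {S\<in>F. level F S mod 2 = i} overlap
          ((clean_const (Suc v) * Suc J) * (gen_const v * Suc J ^ (v - 1)))" unfolding D_def .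
    qed simp
    moreover have "2 * ((clean_const (Suc v) * Suc J) * (gen_const v * Suc J ^ (v - 1))) =
        gen_const (Suc v) * Suc J ^ (Suc v - 1)"
      using False by (cases v) (simp_all only: gen_const.simps if_False nat.distinct diff_Suc_1 power_Suc mult_ac)
    ultimately show ?thesis by (simp only:)
  qed
qed

section \<open>Binary lengths and the iterated logarithm\<close>

definition bits :: "nat \<Rightarrow> nat" where
  "bits m = Suc (nat \<lfloor>log 2 (real m)\<rfloor>)"

lemma less_two_power_bits: "0 < m \<Longrightarrow> m < 2 ^ bits m"
proof -
  assume m: "0 < m"
  have "log 2 (real m) < real (bits m)" unfolding bits_def by linarith
  then have "real m < 2 powr real (bits m)" using m by (simp add: log_less_iff)
  also have "\<dots> = real (2 ^ bits m)" by (simp add: powr_realpow)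
  finally show ?thesis by linarith
qed

lemma bits_le: "0 < m \<Longrightarrow> real (bits m) \<le> log 2 (real m) + 1"
proof -
  assume m: "0 < m"
  have "0 \<le> log 2 (real m)" using m by simp
  then show ?thesis unfolding bits_def by linarith
qed

lemma bits_bits_bigo:
  "(\<lambda>n. real (Suc (bits (bits (2 * Suc n))))) \<in> O(\<lambda>n. ln (ln (real n)))"
proof -
  have "real (Suc (bits (bits (2 * Suc n)))) \<le> log 2 (log 2 (2 * (real n + 1)) + 1) + 2" for n
  proof -
    have pos: "0 < bits (2 * Suc n)" unfolding bits_def by simp
    have "real (bits (2 * Suc n)) \<le> log 2 (2 * (real n + 1)) + 1"
      using bits_le[of "2 * Suc n"] by (simp add: algebra_simps)
    then have "log 2 (real (bits (2 * Suc n))) \<le> log 2 (log 2 (2 * (real n + 1)) + 1)"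
      using pos by (intro log_le_cancel_iff[THEN iffD2]) auto
    then show ?thesis using bits_le[OF pos] by linarith
  qed
  then have "(\<lambda>n. real (Suc (bits (bits (2 * Suc n))))) \<in> O(\<lambda>n. log 2 (log 2 (2 * (real n + 1)) + 1) + 2)"
    by (intro landau_o.big_mono always_eventually allI) (smt (verit, best) of_nat_0_le_iff real_norm_def)
  also have "(\<lambda>n. log 2 (log 2 (2 * (real n + 1)) + 1) + 2) \<in> O(\<lambda>n. ln (ln (real n)))"
    by real_asymp
  finally show ?thesis .
qed

section \<open>From overlap models to graphs\<close>

lemma chromatic_number_le:
  assumes model: "rectangle_overlap_model G \<mu> F" and G: "pair_graph G" and c: "colb F overlap k"
  shows "chromatic_number G \<le> k"
proof -
  interpret pair_graph G by (rule G)
  obtain f where f: "\<forall>x\<in>F. f x < k" "\<forall>x\<in>F. \<forall>y\<in>F. overlap x y \<longrightarrow> f x \<noteq> f y"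
    using c by (rule colbE)
  have mu: "\<mu> u \<in> F" if "u \<in> pverts G" for u
    using model that unfolding rectangle_overlap_model_def bij_betw_def by blast
  have "proper_coloring G k (\<lambda>u. f (\<mu> u))"
    unfolding proper_coloring_def
  proof (intro conjI ballI)
    show "(\<lambda>u. f (\<mu> u)) ` pverts G \<subseteq> {..<k}" using f(1) mu by blast
    fix e assume e: "e \<in> parcs G"
    obtain u v where uv: "e = (u, v)" by fastforce
    then have V: "u \<in> pverts G" "v \<in> pverts G" using e in_arcsD1 in_arcsD2 by blast+
    then have "overlap (\<mu> u) (\<mu> v)" using model e uv unfolding rectangle_overlap_model_def by blast
    then show "case e of (u, v) \<Rightarrow> f (\<mu> u) \<noteq> f (\<mu> v)" using f(2) mu V uv by auto
  qed
  then show ?thesis unfolding chromatic_number_def by (intro Least_le) blast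
qed

lemma model_family:
  assumes model: "rectangle_overlap_model G \<mu> F" and G: "pair_graph G"
  shows "finite F" "card F = card (pverts G)" "\<And>A. A \<in> F \<Longrightarrow> rectangle A" "cliques_le F (clique_number G)"
proof -
  interpret pair_graph G by (rule G)
  have bij: "inj_on \<mu> (pverts G)" "F = \<mu> ` pverts G"
    and adj: "\<And>u v. u \<in> pverts G \<Longrightarrow> v \<in> pverts G \<Longrightarrow> (u, v) \<in> parcs G \<longleftrightarrow> overlap (\<mu> u) (\<mu> v)"
    using model unfolding rectangle_overlap_model_def bij_betw_def by auto
  show "finite F" "card F = card (pverts G)" using bij pair_finite_verts by (simp_all add: card_image)
  show "rectangle A" if "A \<in> F" for A using model that unfolding rectangle_overlap_model_def by blast
  show "cliques_le F (clique_number G)" unfolding cliques_le_def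
  proof (intro allI impI)
    fix K assume K: "K \<subseteq> F" "\<forall>A\<in>K. \<forall>B\<in>K. A \<noteq> B \<longrightarrow> overlap A B"
    then obtain U where U: "U \<subseteq> pverts G" "K = \<mu> ` U" unfolding bij(2) by (meson subset_imageE)
    have "clique_in G U" unfolding clique_in_def
    proof (intro conjI ballI impI)
      fix u v assume uv: "u \<in> U" "v \<in> U" "u \<noteq> v"
      then have V: "u \<in> pverts G" "v \<in> pverts G" using U(1) by blast+
      then have "\<mu> u \<noteq> \<mu> v" using bij(1) uv(3) by (meson inj_onD)
      then show "(u, v) \<in> parcs G" using K(2) uv adj[OF V] unfolding U(2) by blast
    qed fact
    moreover have "finite {K. clique_in G K}"
      by (rule finite_subset[of _ "Pow (pverts G)"]) (auto simp: clique_in_def pair_finite_verts)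
    ultimately have "card U \<le> clique_number G" unfolding clique_number_def by (intro Max_ge) auto
    moreover have "card K = card U" unfolding U(2) using inj_on_subset[OF bij(1) U(1)] by (rule card_image)
    ultimately show "card K \<le> clique_number G" by simp
  qed
qed

theorem theorem1p3:
  shows "chi_bigO (rectangle_overlap_graph :: 'a pair_pre_digraph \<Rightarrow> bool)
           (\<lambda>\<omega> n. ln (ln (real n)) ^ (\<omega> - 1))
       \<and> chi_bigO (clean_rectangle_overlap_graph :: 'a pair_pre_digraph \<Rightarrow> bool)
           (\<lambda>\<omega> n. ln (ln (real n)))"
proof
  \<comment> \<open>This is the factor \<open>Suc J\<close> of the colouring bounds, for
    \<open>K = bits (2 * Suc n)\<close> and \<open>J = bits K\<close>.\<close>
  define J where "J n = Suc (bits (bits (2 * Suc n)))" for n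
  have bnd: "2 * Suc n < 2 ^ bits (2 * Suc n)" "bits (2 * Suc n) < 2 ^ bits (bits (2 * Suc n))" for n
    by (rule less_two_power_bits, simp)+ (simp add: bits_def)
  have J: "(\<lambda>n. real (J n)) \<in> O(\<lambda>n. ln (ln (real n)))" unfolding J_def by (rule bits_bits_bigo)
  show "chi_bigO (rectangle_overlap_graph :: 'a pair_pre_digraph \<Rightarrow> bool)
           (\<lambda>\<omega> n. ln (ln (real n)) ^ (\<omega> - 1))"
    unfolding chi_bigO_def
  proof (intro allI exI conjI impI)
    fix \<omega> :: nat
    show "(\<lambda>n. real (gen_const \<omega>) * real (J n) ^ (\<omega> - 1)) \<in> O(\<lambda>n. ln (ln (real n)) ^ (\<omega> - 1))"
      using landau_o.big_power[OF J, of "\<omega> - 1"] by (cases "gen_const \<omega> = 0") simp_all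
    fix G :: "'a pair_pre_digraph"
    assume "rectangle_overlap_graph G \<and> clique_number G = \<omega>"
    then obtain \<mu> F where G: "pair_graph G" and model: "rectangle_overlap_model G \<mu> F"
      and w: "clique_number G = \<omega>" unfolding rectangle_overlap_graph_def by blast
    note F = model_family[OF model G]
    have "colb F overlap (gen_const \<omega> * J (card (pverts G)) ^ (\<omega> - 1))"
      unfolding J_def
      by (rule colb_rectangles[OF F(1,3)]) (use F(4) w bnd[of "card F"] F(2) in simp_all)
    then have "chromatic_number G \<le> gen_const \<omega> * J (card (pverts G)) ^ (\<omega> - 1)"
      by (rule chromatic_number_le[OF model G])
    then show "real (chromatic_number G) \<le> real (gen_const \<omega>) * real (J (card (pverts G))) ^ (\<omega> - 1)"
      by (metis of_nat_le_iff of_nat_mult of_nat_power)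
  qed
  show "chi_bigO (clean_rectangle_overlap_graph :: 'a pair_pre_digraph \<Rightarrow> bool)
           (\<lambda>\<omega> n. ln (ln (real n)))"
    unfolding chi_bigO_def
  proof (intro allI exI conjI impI)
    fix \<omega> :: nat
    show "(\<lambda>n. real (clean_const \<omega>) * real (J n)) \<in> O(\<lambda>n. ln (ln (real n)))"
      using J by (cases "clean_const \<omega> = 0") simp_all
    fix G :: "'a pair_pre_digraph"
    assume "clean_rectangle_overlap_graph G \<and> clique_number G = \<omega>"
    then obtain \<mu> F where G: "pair_graph G" and model: "rectangle_overlap_model G \<mu> F"
      and cl: "clean_family F" and w: "clique_number G = \<omega>"
      unfolding clean_rectangle_overlap_graph_def by blast
    note F = model_family[OF model G]
    have "colb F overlap (clean_const \<omega> * J (card (pverts G)))"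
      unfolding J_def
      by (rule colb_clean[OF F(1,3) cl]) (use F(4) w bnd[of "card F"] F(2) in simp_all)
    then have "chromatic_number G \<le> clean_const \<omega> * J (card (pverts G))"
      by (rule chromatic_number_le[OF model G])
    then show "real (chromatic_number G) \<le> real (clean_const \<omega>) * real (J (card (pverts G)))"
      by (metis of_nat_le_iff of_nat_mult)
  qed
qed

end
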